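(* The top cycle is the only pairwise social choice correspondence that satisfies (Fishburn-)strategyproofness, set non-imposition, and homogeneity.
   Context: Let $\mathbb{N}=\{1,2,\dots\}$ be the set of potential voters and $A$ a finite set of alternatives. An electorate is a finite non-empty $N\subseteq\mathbb{N}$; each voter $i\in N$ has a strict total order $\succ_i$ on $A$. A preference profile is $R\in\mathcal{R}(A)^N$ for some electorate $N$; $\mathcal{R}^*(A)$ is the set of all profiles over all electorates. The majority margin is $g_R(x,y)=|\{i: x\succ_i y\}|-|\{i: y\succ_i x\}|$; $x\succsim_R y$ iff $g_R(x,y)\ge0$, with strict part $\succ_R$. For sets, $X\succ Y$ means $x\succ y$ for all $x\in X,y\in Y$. A non-empty $X\subseteq A$ is dominant in $R$ if $X\succ_R A\setminus X$. The top cycle $\mathrm{TC}(R)$ is the inclusion-smallest dominant set (dominant sets are totally ordered by inclusion), equivalently the set of $x$ such that for every $y$ there is a path $x=x_1\succsim_R x_2\succsim_R\dots\succsim_R x_k=y$. An SCC is a map $f:\mathcal{R}^*(A)\to 2^A\setminus\{\emptyset\}$. $f$ is pairwise if $f(R)=f(R')$ whenever $g_R=g_{R'}$. $f$ satisfies set non-imposition if for every non-empty $X\subseteq A$ some profile $R$ has $f(R)=X$. $f$ is homogeneous if $f(kR)=f(R)$ for every profile $R$ and $k\ge1$, where $kR$ consists of $k$ copies of $R$. Fishburn's extension: for $X\neq Y$, $X\succ_i^F Y$ iff $X\setminus Y\succ_i Y$ and $X\succ_i Y\setminus X$. $f$ is strategyproof if there is no electorate $N$, voter $i\in N$ and profiles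 $R,R'\in\mathcal{R}(A)^N$ with $\succ_j=\succ'_j$ for all $j\ne i$ and $f(R')\succ_i^F f(R)$. *)

theory Defs
  imports Main
begin

text \<open>Alternatives: a finite type 'a (so A = UNIV). Voters: positive naturals.
  A profile is a pair (N, P): electorate N and preference relations P i
  (x,y) \<in> P i meaning x \<succ>_i y. Outside N, P i is required to be empty,
  so that a profile is determined by its voters' preferences.\<close>

type_synonym 'a profile = "nat set \<times> (nat \<Rightarrow> ('a \<times> 'a) set)"

definition valid_profile :: "'a profile \<Rightarrow> bool" where
  "valid_profile R \<longleftrightarrow>
     finite (fst R) \<and> fst R \<noteq> {} \<and> 0 \<notin> fst R \<and>
     (\<forall>i\<in>fst R. strict_linear_order_on UNIV (snd R i)) \<and>
     (\<forall>i. i \<notin> fst R \<longrightarrow> snd R i = {})"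

definition margin :: "'a profile \<Rightarrow> 'a \<Rightarrow> 'a \<Rightarrow> int" where
  "margin R x y = int (card {i\<in>fst R. (x,y) \<in> snd R i}) - int (card {i\<in>fst R. (y,x) \<in> snd R i})"

definition maj_strict :: "'a profile \<Rightarrow> 'a \<Rightarrow> 'a \<Rightarrow> bool" where
  "maj_strict R x y \<longleftrightarrow> margin R x y > 0"

definition dominant :: "'a profile \<Rightarrow> 'a set \<Rightarrow> bool" where
  "dominant R X \<longleftrightarrow> X \<noteq> {} \<and> (\<forall>x\<in>X. \<forall>y\<in>UNIV - X. maj_strict R x y)"

definition top_cycle :: "'a profile \<Rightarrow> 'a set" where
  "top_cycle R = (THE X. dominant R X \<and> (\<forall>Y. dominant R Y \<longrightarrow> X \<subseteq> Y))"

definition is_SCC :: "('a profile \<Rightarrow> 'a set) \<Rightarrow> bool" where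
  "is_SCC f \<longleftrightarrow> (\<forall>R. valid_profile R \<longrightarrow> f R \<noteq> {})"

definition pairwise_SCC :: "('a profile \<Rightarrow> 'a set) \<Rightarrow> bool" where
  "pairwise_SCC f \<longleftrightarrow> (\<forall>R R'. valid_profile R \<longrightarrow> valid_profile R' \<longrightarrow>
      margin R = margin R' \<longrightarrow> f R = f R')"

definition set_non_imposition :: "('a profile \<Rightarrow> 'a set) \<Rightarrow> bool" where
  "set_non_imposition f \<longleftrightarrow> (\<forall>X::'a set. X \<noteq> {} \<longrightarrow> (\<exists>R. valid_profile R \<and> f R = X))"

definition copies_of :: "nat \<Rightarrow> 'a profile \<Rightarrow> 'a profile \<Rightarrow> bool" where
  "copies_of k R' R \<longleftrightarrow> (\<exists>h. h ` fst R' \<subseteq> fst R \<and>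
      (\<forall>i\<in>fst R. card {j\<in>fst R'. h j = i} = k) \<and>
      (\<forall>j\<in>fst R'. snd R' j = snd R (h j)))"

definition homogeneous :: "('a profile \<Rightarrow> 'a set) \<Rightarrow> bool" where
  "homogeneous f \<longleftrightarrow> (\<forall>k R R'. k \<ge> 1 \<longrightarrow> valid_profile R \<longrightarrow> valid_profile R' \<longrightarrow>
      copies_of k R' R \<longrightarrow> f R' = f R)"

definition fishburn_pref :: "('a \<times> 'a) set \<Rightarrow> 'a set \<Rightarrow> 'a set \<Rightarrow> bool" where
  "fishburn_pref r X Y \<longleftrightarrow> X \<noteq> Y \<and>
     (\<forall>x\<in>X - Y. \<forall>y\<in>Y. (x,y) \<in> r) \<and> (\<forall>x\<in>X. \<forall>y\<in>Y - X. (x,y) \<in> r)"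

definition strategyproof :: "('a profile \<Rightarrow> 'a set) \<Rightarrow> bool" where
  "strategyproof f \<longleftrightarrow> (\<forall>N P P' i. valid_profile (N,P) \<longrightarrow> valid_profile (N,P') \<longrightarrow>
      i \<in> N \<longrightarrow> (\<forall>j\<in>N - {i}. P j = P' j) \<longrightarrow>
      \<not> fishburn_pref (P i) (f (N,P')) (f (N,P)))"

end

theory Submission
  imports Defs
begin

text \<open>Since margins are realizable up to a factor 2, which homogeneity removes, \<open>f\<close> induces a function \<open>G\<close> on
  all skew-symmetric integer matrices. Comparing a vote ranking \<open>x\<close> directly above \<open>y\<close> with the vote in which
  the two are swapped shows that raising \<open>y\<close> over \<open>x\<close> by one unit changes \<open>G g\<close> only in three ways
  (lemma \<open>transition\<close>), and that an alternative outside \<open>G g\<close> can be weakened uniformly against \<open>G g\<close> for free.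
  Induction on \<open>m\<close> then proves \<open>G g = V\<close> whenever \<open>G g\<close> or the top cycle \<open>V\<close> has at most \<open>m\<close> elements.
  A top cycle of size \<open>m\<close> is reached from a matrix with choice set \<open>V\<close> (set non-imposition) by
  single raises keeping \<open>V\<close> the top cycle: an expelled \<open>v \<in> V\<close> could be pushed to the bottom, which would make
  the top cycle smaller. If a choice set \<open>X\<close> of size \<open>m\<close> were not dominant, weakening an outsider \<open>z\<close> would produce
  the top cycle \<open>V = X \<union> {z}\<close> with choice set \<open>V - {z}\<close>. While \<open>V\<close> stays the top cycle, the choice
  set keeps the form \<open>V - {c}\<close> with \<open>V - {c}\<close> strongly connected unless \<open>c\<close> itself is raised; steering \<open>c\<close> by
  raising other alternatives ends in a matrix where \<open>V - {c}\<close> is not strongly connected. For \<open>m = 1\<close>, where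
  singletons are always strongly connected, set non-imposition for pairs is used instead.\<close>

section \<open>Skew-symmetric matrices and their top cycles\<close>

definition skew :: "('a \<Rightarrow> 'a \<Rightarrow> int) \<Rightarrow> bool" where
  "skew g \<longleftrightarrow> (\<forall>a b. g a b + g b a = 0)"

text \<open>\<open>y\<close> gains one unit against \<open>x\<close>; for \<open>x = y\<close> the
  two terms cancel. With margins halved, one unit is a single voter swapping two adjacent
  alternatives.\<close>

definition inc :: "'a \<Rightarrow> 'a \<Rightarrow> ('a \<Rightarrow> 'a \<Rightarrow> int) \<Rightarrow> 'a \<Rightarrow> 'a \<Rightarrow> int" where
  "inc y x g = (\<lambda>a b. g a b + of_bool (a = y \<and> b = x) - of_bool (a = x \<and> b = y))"

definition between :: "('a \<Rightarrow> 'a \<Rightarrow> int) \<Rightarrow> ('a \<Rightarrow> 'a \<Rightarrow> int) \<Rightarrow> ('a \<Rightarrow> 'a \<Rightarrow> int) \<Rightarrow> bool" where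
  "between g h k \<longleftrightarrow> (\<forall>a b. min (g a b) (h a b) \<le> k a b \<and> k a b \<le> max (g a b) (h a b))"

definition dominates :: "('a \<Rightarrow> 'a \<Rightarrow> int) \<Rightarrow> 'a set \<Rightarrow> 'a set \<Rightarrow> bool" where
  "dominates g S T \<longleftrightarrow> (\<forall>a\<in>S. \<forall>b\<in>T. 0 < g a b)"

text \<open>For skew \<open>g\<close> this is strong connectivity of the weak majority relation
  \<open>0 \<le> g a b\<close> on \<open>V\<close>.\<close>

definition strong :: "('a \<Rightarrow> 'a \<Rightarrow> int) \<Rightarrow> 'a set \<Rightarrow> bool" where
  "strong g V \<longleftrightarrow> (\<forall>S. S \<noteq> {} \<longrightarrow> S \<subset> V \<longrightarrow> \<not> dominates g S (V - S))"

definition is_tc :: "('a \<Rightarrow> 'a \<Rightarrow> int) \<Rightarrow> 'a set \<Rightarrow> bool" where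
  "is_tc g V \<longleftrightarrow> V \<noteq> {} \<and> dominates g V (- V) \<and> strong g V"

lemma skewD: "skew g \<Longrightarrow> g a b + g b a = 0"
  unfolding skew_def by blast

lemma skew_diag: "skew g \<Longrightarrow> g a a = 0"
  using skewD[of g a a] by simp

lemma skew_inc [simp]: "skew g \<Longrightarrow> skew (inc y x g)"
proof -
  assume g: "skew g"
  have "inc y x g a b + inc y x g b a = 0" for a b
    using skewD[OF g, of a b] by (simp add: inc_def conj_commute)
  then show ?thesis unfolding skew_def by blast
qed

lemma inc_apply:
  "inc y x g a b = (if a = y \<and> b = x \<and> x \<noteq> y then g a b + 1
                    else if a = x \<and> b = y \<and> x \<noteq> y then g a b - 1 else g a b)"
  by (auto simp: inc_def)

lemma betweenD: "between g h k \<Longrightarrow> min (g a b) (h a b) \<le> k a b \<and> k a b \<le> max (g a b) (h a b)"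
  unfolding between_def by blast

lemma inc_between:
  assumes "skew k" "skew h" "between g h k" "k y x < h y x"
  shows "between g h (inc y x k)"
proof -
  have "x \<noteq> y" using assms(1,2,4) skew_diag[of k x] skew_diag[of h x] by auto
  moreover have "h x y < k x y" using assms skewD[of h x y] skewD[of k x y] by simp
  ultimately show ?thesis
    unfolding between_def
  proof (intro allI)
    fix a b
    show "min (g a b) (h a b) \<le> inc y x k a b \<and> inc y x k a b \<le> max (g a b) (h a b)"
      using betweenD[OF assms(3), of a b] assms(4) \<open>x \<noteq> y\<close> \<open>h x y < k x y\<close>
      by (auto simp: inc_apply)
  qed
qed

text \<open>Unit raises of deficient pairs lower the entrywise distance to \<open>h\<close>, so
  \<open>g\<close> turns into \<open>h\<close> monotonically in every entry. Each step may therefore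
  assume that both of its matrices lie between the two ends.\<close>

lemma path_induct [consumes 3, case_names step]:
  fixes g h :: "'a::finite \<Rightarrow> 'a \<Rightarrow> int"
  assumes skew: "skew g" "skew h" and base: "P g"
    and step: "\<And>k y x. skew k \<Longrightarrow> between g h k \<Longrightarrow> between g h (inc y x k) \<Longrightarrow> g y x \<le> k y x \<Longrightarrow>
                 k y x < h y x \<Longrightarrow> y \<noteq> x \<Longrightarrow> P k \<Longrightarrow> P (inc y x k)"
  shows "P h"
proof -
  define d where "d k = (\<Sum>a\<in>UNIV. \<Sum>b\<in>UNIV. nat \<bar>h a b - k a b\<bar>)" for k
  have "P h" if "skew k" "between g h k" "P k" for k
    using that
  proof (induction "d k" arbitrary: k rule: less_induct)
    case less
    show ?case
    proof (cases "k = h")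
      case False
      then obtain a b where "k a b \<noteq> h a b" by (auto simp: fun_eq_iff)
      then obtain y x where lt: "k y x < h y x"
        using skewD[OF less.prems(1), of a b] skewD[OF skew(2), of a b]
        by (metis add_le_imp_le_left add_less_cancel_left linorder_neqE_linordered_idom add_less_cancel_right)
      have ne: "y \<noteq> x" using lt less.prems(1) skew skew_diag[of k x] skew_diag[of h x] by auto
      have lt': "h x y < k x y"
        using lt skewD[OF less.prems(1), of x y] skewD[OF skew(2), of x y] by simp
      have bt: "between g h (inc y x k)" by (rule inc_between[OF less.prems(1) skew(2) less.prems(2) lt])
      have gk: "g y x \<le> k y x" using betweenD[OF less.prems(2), of y x] lt by linarith
      have le: "nat \<bar>h a b - inc y x k a b\<bar> \<le> nat \<bar>h a b - k a b\<bar>" for a b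
        using lt lt' ne by (auto simp: inc_apply)
      have "d (inc y x k) < d k" unfolding d_def
      proof (rule sum_strict_mono_ex1)
        show "\<forall>a\<in>UNIV. (\<Sum>b\<in>UNIV. nat \<bar>h a b - inc y x k a b\<bar>) \<le> (\<Sum>b\<in>UNIV. nat \<bar>h a b - k a b\<bar>)"
          using le by (auto intro: sum_mono)
        have "(\<Sum>b\<in>UNIV. nat \<bar>h y b - inc y x k y b\<bar>) < (\<Sum>b\<in>UNIV. nat \<bar>h y b - k y b\<bar>)"
          by (rule sum_strict_mono_ex1)
            (use le lt ne in \<open>auto intro!: bexI[of _ x] simp: inc_apply\<close>)
        then show "\<exists>a\<in>UNIV. (\<Sum>b\<in>UNIV. nat \<bar>h a b - inc y x k a b\<bar>) < (\<Sum>b\<in>UNIV. nat \<bar>h a b - k a b\<bar>)"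
          by blast
      qed simp
      from less.hyps[OF this skew_inc[OF less.prems(1)] bt step[OF less.prems(1,2) bt gk lt ne less.prems(3)]]
      show ?thesis .
    qed (use less.prems in simp)
  qed
  from this[OF skew(1) _ base] show ?thesis by (auto simp: between_def)
qed

lemma dominatesD: "dominates g S T \<Longrightarrow> a \<in> S \<Longrightarrow> b \<in> T \<Longrightarrow> 0 < g a b"
  by (auto simp: dominates_def)

lemma strong_cut:
  assumes "skew g" "strong g V" "S \<noteq> {}" "S \<subset> V"
  obtains a b where "a \<in> V - S" "b \<in> S" "0 \<le> g a b"
proof -
  have "\<not> dominates g S (V - S)" using assms(2-4) by (auto simp: strong_def)
  then obtain a b where "b \<in> S" "a \<in> V - S" "\<not> 0 < g b a" unfolding dominates_def by blast
  then show ?thesis using that[of a b] skewD[OF assms(1), of a b] by linarith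
qed

lemma strongI:
  assumes "skew g"
    and "\<And>S. S \<noteq> {} \<Longrightarrow> S \<subset> V \<Longrightarrow> \<exists>a\<in>V - S. \<exists>b\<in>S. 0 \<le> g a b"
  shows "strong g V"
  unfolding strong_def
proof (intro allI impI notI)
  fix S assume S: "S \<noteq> {}" "S \<subset> V" "dominates g S (V - S)"
  obtain a b where ab: "a \<in> V - S" "b \<in> S" "0 \<le> g a b" using assms(2)[OF S(1,2)] by blast
  show False using dominatesD[OF S(3) ab(2,1)] ab(3) skewD[OF assms(1), of a b] by linarith
qed

lemma strong_mono:
  assumes "skew g" "skew h" "strong g V" "\<And>a b. a \<in> V \<Longrightarrow> b \<in> V \<Longrightarrow> 0 \<le> g a b \<Longrightarrow> 0 \<le> h a b"
  shows "strong h V"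
proof (rule strongI[OF assms(2)])
  fix S assume S: "S \<noteq> {}" "S \<subset> V"
  obtain a b where "a \<in> V - S" "b \<in> S" "0 \<le> g a b" by (rule strong_cut[OF assms(1,3) S])
  then show "\<exists>a\<in>V - S. \<exists>b\<in>S. 0 \<le> h a b" using assms(4)[of a b] S by blast
qed

lemma strong_insert:
  assumes "skew g" "strong g X" "a \<in> X" "0 \<le> g a c" "b \<in> X" "0 \<le> g c b"
  shows "strong g (insert c X)"
proof (cases "c \<in> X")
  case False
  show ?thesis
  proof (rule strongI[OF assms(1)])
    fix S assume S: "S \<noteq> {}" "S \<subset> insert c X"
    consider "S \<inter> X \<noteq> {}" "S \<inter> X \<subset> X" | "S = {c}" | "S = X"
      using S False by blast
    then show "\<exists>a\<in>insert c X - S. \<exists>b\<in>S. 0 \<le> g a b"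
    proof cases
      case 1
      obtain a b where "a \<in> X - S \<inter> X" "b \<in> S \<inter> X" "0 \<le> g a b"
        by (rule strong_cut[OF assms(1,2) 1])
      then show ?thesis by blast
    qed (use assms False in auto)
  qed
qed (use assms in \<open>simp add: insert_absorb\<close>)

lemma not_strong: "S \<noteq> {} \<Longrightarrow> S \<subset> V \<Longrightarrow> dominates g S (V - S) \<Longrightarrow> \<not> strong g V"
  by (auto simp: strong_def)

text \<open>Dominant sets are nested, since an element of \<open>V - W\<close> and one of
  \<open>W - V\<close> would beat each other. A dominant \<open>W\<close> properly inside
  \<open>V\<close> would be a forbidden cut of \<open>V\<close>.\<close>

lemma tc_subset_dominant:
  assumes "skew g" "is_tc g V" "dominates g W (- W)" "W \<noteq> {}"
  shows "V \<subseteq> W"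
proof (rule ccontr)
  assume "\<not> V \<subseteq> W"
  then obtain a where a: "a \<in> V" "a \<notin> W" by blast
  have "W \<subseteq> V"
  proof
    fix b assume b: "b \<in> W"
    show "b \<in> V"
    proof (rule ccontr)
      assume "b \<notin> V"
      then have "0 < g a b" "0 < g b a"
        using a b assms(2,3) by (auto simp: is_tc_def dominates_def)
      then show False using skewD[OF assms(1), of a b] by simp
    qed
  qed
  then have "W \<subset> V" using a by blast
  moreover have "dominates g W (V - W)" using assms(3) by (auto simp: dominates_def)
  ultimately show False using assms(2,4) unfolding is_tc_def strong_def by blast
qed

lemma tc_unique: "skew g \<Longrightarrow> is_tc g V \<Longrightarrow> is_tc g W \<Longrightarrow> V = W"
  using tc_subset_dominant[of g V W] tc_subset_dominant[of g W V] by (auto simp: is_tc_def)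

lemma tc_exists_subset:
  fixes g :: "'a::finite \<Rightarrow> 'a \<Rightarrow> int"
  assumes "dominates g W (- W)" "W \<noteq> {}"
  obtains V where "is_tc g V" "V \<subseteq> W"
proof -
  have "\<exists>V. is_tc g V \<and> V \<subseteq> W"
    using assms
  proof (induction "card W" arbitrary: W rule: less_induct)
    case less
    show ?case
    proof (cases "strong g W")
      case False
      then obtain S where S: "S \<noteq> {}" "S \<subset> W" "dominates g S (W - S)"
        unfolding strong_def by blast
      then have "dominates g S (- S)" using less.prems(1) by (auto simp: dominates_def)
      moreover have "card S < card W" using S by (simp add: psubset_card_mono)
      ultimately obtain V where "is_tc g V" "V \<subseteq> S" using less.hyps[of S] S by blast
      then show ?thesis using S by blast
    qed (use less.prems in \<open>auto simp: is_tc_def\<close>)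
  qed
  then show ?thesis using that by blast
qed

section \<open>Manipulations by a single voter\<close>

text \<open>Small values are preferred: \<open>k\<close> assigns levels, and \<open>e\<close> breaks
  ties within a level.\<close>

definition lex_order :: "('a \<Rightarrow> int) \<Rightarrow> ('a \<Rightarrow> int) \<Rightarrow> ('a \<times> 'a) set" where
  "lex_order k e = {(a, b). k a < k b \<or> k a = k b \<and> e a < e b}"

lemma strict_linear_order_lex_order: "inj e \<Longrightarrow> strict_linear_order_on UNIV (lex_order k e)"
  unfolding strict_linear_order_on_def lex_order_def trans_def irrefl_def total_on_def
  by (auto dest: injD) (metis injD linorder_neqE_linordered_idom)

lemma ex_injection: "\<exists>e :: 'a::finite \<Rightarrow> int. inj e"
proof -
  obtain e :: "'a \<Rightarrow> nat" where "inj e"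
    using finite_imp_inj_to_nat_seg[OF finite_UNIV] by auto
  then have "inj (\<lambda>a. int (e a))" by (auto simp: inj_def)
  then show ?thesis by blast
qed

text \<open>Within a level that they share, \<open>x\<close> and \<open>y\<close> come first and
  adjacent, so exchanging their values alters a vote in this one pair only.\<close>

lemma ex_adjacent_injection:
  fixes x y :: "'a::finite"
  assumes "x \<noteq> y"
  shows "\<exists>e :: 'a \<Rightarrow> int. inj e \<and> e x = 0 \<and> e y = 1 \<and> (\<forall>a. a \<noteq> x \<and> a \<noteq> y \<longrightarrow> 1 < e a)"
proof -
  obtain e0 :: "'a \<Rightarrow> nat" where e0: "inj e0"
    using finite_imp_inj_to_nat_seg[OF finite_UNIV] by auto
  let ?e = "(\<lambda>a. int (e0 a) + 2)(x := 0, y := 1)"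
  have "inj ?e"
  proof (rule injI)
    fix a b assume "?e a = ?e b"
    then show "a = b" using injD[OF e0, of a b] by (auto split: if_splits)
  qed
  moreover have "\<forall>a. a \<noteq> x \<and> a \<noteq> y \<longrightarrow> 1 < ?e a" by simp
  ultimately show ?thesis using assms by (intro exI[of _ ?e]) simp
qed

text \<open>Changing a vote from \<open>r\<close> to \<open>r'\<close> changes the margins by twice the increment added here.\<close>

definition shift :: "('a \<times> 'a) set \<Rightarrow> ('a \<times> 'a) set \<Rightarrow> ('a \<Rightarrow> 'a \<Rightarrow> int) \<Rightarrow> 'a \<Rightarrow> 'a \<Rightarrow> int" where
  "shift r r' g = (\<lambda>a b. g a b + of_bool ((a, b) \<in> r') - of_bool ((a, b) \<in> r))"

lemma shift_shift: "shift r' r (shift r r' g) = g"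
  by (auto simp: shift_def)

text \<open>For \<open>u \<notin> X\<close>, the \<open>shift\<close> of a voter who moves
  \<open>u\<close> from the top to directly below \<open>X\<close>, where \<open>X\<close> precedes
  all other alternatives.\<close>

definition raise :: "'a set \<Rightarrow> 'a \<Rightarrow> ('a \<Rightarrow> 'a \<Rightarrow> int) \<Rightarrow> 'a \<Rightarrow> 'a \<Rightarrow> int" where
  "raise X u g = (\<lambda>a b. g a b + of_bool (a \<in> X \<and> b = u) - of_bool (a = u \<and> b \<in> X))"

lemma skew_raise: "skew g \<Longrightarrow> skew (raise X u g)"
proof -
  assume g: "skew g"
  have "raise X u g a b + raise X u g b a = 0" for a b
    using skewD[OF g, of a b] by (simp add: raise_def conj_commute)
  then show ?thesis unfolding skew_def by blast
qed

text \<open>\<open>G\<close> acts on halved margins. \<open>sp\<close>, \<open>hom\<close>,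
  \<open>onto\<close> and \<open>ne\<close> are the forms that strategyproofness, homogeneity, set
  non-imposition and non-emptiness take there.\<close>

locale margin_rule =
  fixes G :: "('a::finite \<Rightarrow> 'a \<Rightarrow> int) \<Rightarrow> 'a set"
  assumes sp: "skew g \<Longrightarrow> strict_linear_order_on UNIV r \<Longrightarrow> strict_linear_order_on UNIV r' \<Longrightarrow>
      skew (shift r r' g) \<Longrightarrow> \<not> fishburn_pref r (G (shift r r' g)) (G g)"
    and hom: "skew g \<Longrightarrow> 1 \<le> n \<Longrightarrow> G (\<lambda>a b. int n * g a b) = G g"
    and onto: "X \<noteq> {} \<Longrightarrow> \<exists>g. skew g \<and> G g = X"
    and ne: "skew g \<Longrightarrow> G g \<noteq> {}"
begin

text \<open>If the levels \<open>k\<close> made \<open>X'\<close> preferred to \<open>X\<close>, a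
  voter with \<open>x\<close> directly above \<open>y\<close> could manipulate by swapping the two.
  The last two assumptions allow the pair \<open>x\<close>, \<open>y\<close> itself because the
  truthful vote has \<open>x\<close> first.\<close>

lemma swap_eq:
  assumes g: "skew g" and "x \<noteq> y" and k: "k x = (k y :: int)"
    and X: "G g = X" "G (inc y x g) = X'"
    and "\<And>a b. a \<in> X' - X \<Longrightarrow> b \<in> X \<Longrightarrow> k a < k b \<or> a = x \<and> b = y"
    and "\<And>a b. a \<in> X' \<Longrightarrow> b \<in> X - X' \<Longrightarrow> k a < k b \<or> a = x \<and> b = y"
  shows "X' = X"
proof -
  obtain e :: "'a \<Rightarrow> int" where e: "inj e" "e x = 0" "e y = 1" "\<forall>a. a \<noteq> x \<and> a \<noteq> y \<longrightarrow> 1 < e a"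
    using ex_adjacent_injection[OF \<open>x \<noteq> y\<close>] by blast
  let ?e = "e(x := 1, y := 0)"
  have inj': "inj ?e"
  proof (rule injI)
    fix a b assume "?e a = ?e b"
    then show "a = b"
      using injD[OF e(1), of a b] e(2,3) e(4)[rule_format, of a] e(4)[rule_format, of b] \<open>x \<noteq> y\<close> by (auto split: if_splits)
  qed
  let ?r = "lex_order k e" and ?r' = "lex_order k ?e"
  have sh: "shift ?r ?r' g = inc y x g"
  proof (intro ext)
    fix a b
    show "shift ?r ?r' g a b = inc y x g a b"
      using e(2,3) e(4)[rule_format, of a] e(4)[rule_format, of b] \<open>x \<noteq> y\<close> k
      unfolding shift_def inc_def lex_order_def
      by (cases "a = x"; cases "a = y"; cases "b = x"; cases "b = y") simp_all
  qed
  have "\<not> fishburn_pref ?r X' X"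
    using sp[OF g strict_linear_order_lex_order[OF e(1)] strict_linear_order_lex_order[OF inj'], of k k,
        unfolded sh, OF skew_inc[OF g]] unfolding X .
  moreover have "(x, y) \<in> ?r" using k e by (simp add: lex_order_def)
  ultimately show ?thesis using assms(6,7) unfolding fishburn_pref_def lex_order_def by blast
qed

text \<open>The manipulation runs backwards: a voter with true vote \<open>r'\<close> would move
  \<open>u\<close> to the top and turn \<open>raise X u g\<close> into \<open>g\<close>.\<close>

lemma raise_eq:
  assumes g: "skew g" and X: "G g = X" and u: "u \<notin> X"
  shows "G (raise X u g) = X"
proof (rule ccontr)
  define X' where "X' = G (raise X u g)"
  assume "G (raise X u g) \<noteq> X"
  then have ne: "X \<noteq> X'" by (simp add: X'_def)
  obtain e :: "'a \<Rightarrow> int" where e: "inj e"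
    using ex_injection by blast
  \<comment> \<open>\<open>r'\<close> ranks \<open>X - X'\<close> over \<open>X \<inter> X'\<close>
    over \<open>u\<close> over the rest, so that \<open>X\<close> is preferred to \<open>X'\<close>;
    \<open>r\<close> differs only by having \<open>u\<close> first.\<close>
  define k' where "k' a = (if a = u then 3 else if a \<in> X - X' then 1 else if a \<in> X then 2 else 4 :: int)" for a
  define r where "r = lex_order (k'(u := 0)) e"
  define r' where "r' = lex_order k' e"
  have sh: "shift r r' g = raise X u g"
    using u by (auto simp: fun_eq_iff shift_def raise_def lex_order_def r_def r'_def k'_def)
  have "shift r' r (raise X u g) = g" by (metis sh shift_shift)
  moreover have "strict_linear_order_on UNIV r" "strict_linear_order_on UNIV r'"
    using strict_linear_order_lex_order[OF e] by (auto simp: r_def r'_def)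
  ultimately have "\<not> fishburn_pref r' X X'"
    using sp[OF skew_raise[OF g], of r' r X u] g X by (simp add: X'_def)
  moreover have "fishburn_pref r' X X'"
    using ne u by (auto simp: fishburn_pref_def r'_def lex_order_def k'_def)
  ultimately show False by simp
qed

text \<open>A Fishburn manipulation needs a vote ranking \<open>X' - X\<close> over \<open>X \<inter> X'\<close> over \<open>X - X'\<close> in which \<open>x\<close> is
  directly above \<open>y\<close>; \<open>t\<close> is the level at which these two are placed.\<close>

lemma transition:
  assumes g: "skew g" and xy: "x \<noteq> y" and X: "G g = X" "G (inc y x g) = X'" and ne: "X' \<noteq> X"
  shows "y \<in> X' - X \<and> x \<in> X \<or> y \<in> X \<inter> X' \<and> x \<in> X - X' \<or> y \<in> X - X' \<and> x \<in> X' - X \<and> X \<inter> X' \<noteq> {}"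
proof (rule ccontr)
  assume neg: "\<not> ?thesis"
  \<comment> \<open>Levels 0, 2 and 4 hold \<open>X' - X\<close>, \<open>X \<inter> X'\<close> and
    all other alternatives; an odd \<open>t\<close> puts \<open>x\<close> and \<open>y\<close>
    between two blocks.\<close>
  define k where "k t a = (if a = x \<or> a = y then t else if a \<in> X' - X then 0 else if a \<in> X' then 2 else 4 :: int)"
    for t a
  have *: "(\<And>a b. a \<in> X' - X \<Longrightarrow> b \<in> X \<Longrightarrow> k t a < k t b \<or> a = x \<and> b = y) \<Longrightarrow>
      (\<And>a b. a \<in> X' \<Longrightarrow> b \<in> X - X' \<Longrightarrow> k t a < k t b \<or> a = x \<and> b = y) \<Longrightarrow> False" for t
  proof -
    have "k t x = k t y" by (simp add: k_def)
    then show "(\<And>a b. a \<in> X' - X \<Longrightarrow> b \<in> X \<Longrightarrow> k t a < k t b \<or> a = x \<and> b = y) \<Longrightarrow>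
      (\<And>a b. a \<in> X' \<Longrightarrow> b \<in> X - X' \<Longrightarrow> k t a < k t b \<or> a = x \<and> b = y) \<Longrightarrow> False"
      using swap_eq[OF g xy _ X, of "k t"] ne by blast
  qed
  consider "x \<notin> X \<union> X'" "y \<in> X' - X" | "x \<notin> X \<union> X'" "y \<in> X' \<inter> X" | "x \<notin> X \<union> X'" "y \<in> X - X'"
    | "x \<notin> X \<union> X'" "y \<notin> X \<union> X'"
    | "x \<in> X' - X" "y \<notin> X" | "x \<in> X' - X" "y \<in> X' \<inter> X" | "x \<in> X' - X" "y \<in> X - X'"
    | "x \<in> X' \<inter> X" "y \<notin> X \<union> X'" | "x \<in> X' \<inter> X" "y \<in> X' \<inter> X" | "x \<in> X' \<inter> X" "y \<in> X - X'"
    | "x \<in> X - X'" "y \<notin> X \<union> X'" | "x \<in> X - X'" "y \<in> X - X'"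
    using neg by (cases "x \<in> X"; cases "x \<in> X'"; cases "y \<in> X"; cases "y \<in> X'") simp_all
  then show False
  proof cases
    case 1 show False by (rule *[of 0]) (use 1 in \<open>auto simp: k_def\<close>)
  next
    case 2 show False by (rule *[of 2]) (use 2 in \<open>auto simp: k_def\<close>)
  next
    case 3 show False by (rule *[of 4]) (use 3 in \<open>auto simp: k_def\<close>)
  next
    case 4 show False by (rule *[of 0]) (use 4 in \<open>auto simp: k_def\<close>)
  next
    case 5 show False by (rule *[of 0]) (use 5 in \<open>auto simp: k_def\<close>)
  next
    case 6 show False by (rule *[of 1]) (use 6 in \<open>auto simp: k_def\<close>)
  next
    case 7 show False by (rule *[of 1]) (use 7 neg in \<open>auto simp: k_def\<close>)
  next
    case 8 show False by (rule *[of 2]) (use 8 in \<open>auto simp: k_def\<close>)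
  next
    case 9 show False by (rule *[of 2]) (use 9 in \<open>auto simp: k_def\<close>)
  next
    case 10 show False by (rule *[of 3]) (use 10 in \<open>auto simp: k_def\<close>)
  next
    case 11 show False by (rule *[of 4]) (use 11 in \<open>auto simp: k_def\<close>)
  next
    case 12 show False by (rule *[of 4]) (use 12 in \<open>auto simp: k_def\<close>)
  qed
qed

text \<open>Uniform gains of \<open>X\<close> over an outsider are iterated uses of
  \<open>raise_eq\<close>. Margins between outsiders are free because each outcome of
  \<open>transition\<close> involves a member of \<open>X\<close>.\<close>

lemma weaken_outside:
  assumes g: "skew g" and h: "skew h" and X: "G g = X"
    and same: "\<And>a b. a \<in> X \<Longrightarrow> b \<in> X \<Longrightarrow> h a b = g a b"
    and up: "\<And>u. u \<notin> X \<Longrightarrow> \<exists>n. \<forall>a\<in>X. h a u = g a u + int n"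
  shows "G h = X"
proof -
  obtain N where N: "\<And>u a. u \<notin> X \<Longrightarrow> a \<in> X \<Longrightarrow> h a u = g a u + int (N u)"
    using up by metis
  define gN where "gN N = (\<lambda>a b. g a b + (if a \<in> X \<and> b \<notin> X then int (N b) else 0)
      - (if b \<in> X \<and> a \<notin> X then int (N a) else 0))" for N :: "'a \<Rightarrow> nat"
  have sk: "skew (gN N)" for N
    unfolding skew_def gN_def using skewD[OF g] by (auto simp: add.commute)
  have "G (gN N) = X"
  proof (induction "sum N UNIV" arbitrary: N rule: less_induct)
    case less
    show ?case
    proof (cases "\<exists>u. 0 < N u")
      case True
      then obtain u where u: "0 < N u" by blast
      let ?N = "N(u := N u - 1)"
      have "sum ?N UNIV < sum N UNIV"
        by (rule sum_strict_mono_ex1) (use u in auto)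
      then have IH: "G (gN ?N) = X" by (rule less.hyps)
      show ?thesis
      proof (cases "u \<in> X")
        case True
        then have "gN N = gN ?N" by (auto simp: gN_def fun_eq_iff)
        then show ?thesis using IH by simp
      next
        case False
        then have "gN N = raise X u (gN ?N)"
          using u by (auto simp: gN_def fun_eq_iff raise_def)
        then show ?thesis using raise_eq[OF sk IH False] by simp
      qed
    next
      case False
      then have "gN N = g" by (auto simp: gN_def fun_eq_iff)
      then show ?thesis using X by simp
    qed
  qed
  then have base: "G (gN N) = X" .
  have out: "gN N a b = h a b" if ab: "a \<in> X \<or> b \<in> X" for a b
  proof -
    consider "a \<in> X" "b \<in> X" | "a \<in> X" "b \<notin> X" | "a \<notin> X" "b \<in> X" using ab by blast
    then show ?thesis
    proof cases
      case 3
      then show ?thesis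
        using N[of a b] skewD[OF g, of a b] skewD[OF h, of a b] by (simp add: gN_def)
    qed (use same N in \<open>auto simp: gN_def\<close>)
  qed
  from sk[of N] h base show ?thesis
  proof (induction rule: path_induct)
    case (step k y x)
    have "y \<notin> X \<and> x \<notin> X"
      using betweenD[OF step(2), of y x] out[of y x] step(5) by (cases "y \<in> X \<or> x \<in> X") auto
    then show ?case
      using transition[OF step(1) step(6)[symmetric] step(7) refl] by blast
  qed
qed

end

section \<open>The induction on the size of the choice set\<close>

lemma ex_bound:
  fixes g :: "'a::finite \<Rightarrow> 'a \<Rightarrow> int"
  shows "\<exists>N::nat. \<forall>a b. \<bar>g a b\<bar> < int N"
proof (intro exI allI)
  fix a b
  have "\<bar>g a b\<bar> \<le> (\<Sum>b\<in>UNIV. \<bar>g a b\<bar>)" by (rule member_le_sum) auto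
  also have "\<dots> \<le> (\<Sum>a\<in>UNIV. \<Sum>b\<in>UNIV. \<bar>g a b\<bar>)"
    by (rule member_le_sum[where f = "\<lambda>a. \<Sum>b\<in>UNIV. \<bar>g a b\<bar>"]) (auto intro: sum_nonneg)
  also have "\<dots> < int (nat (1 + (\<Sum>a\<in>UNIV. \<Sum>b\<in>UNIV. \<bar>g a b\<bar>)))" by simp
  finally show "\<bar>g a b\<bar> < \<dots>" .
qed

definition lift :: "'a set \<Rightarrow> nat \<Rightarrow> ('a \<Rightarrow> 'a \<Rightarrow> int) \<Rightarrow> 'a \<Rightarrow> 'a \<Rightarrow> int" where
  "lift X N g = (\<lambda>a b. g a b + (if a \<in> X \<and> b \<notin> X then int N else 0)
     - (if b \<in> X \<and> a \<notin> X then int N else 0))"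

lemma skew_lift: "skew g \<Longrightarrow> skew (lift X N g)"
  unfolding skew_def lift_def by auto

lemma lift_dominates:
  assumes "\<And>a b. \<bar>g a b\<bar> < int N"
  shows "dominates (lift X N g) X (- X)"
  unfolding dominates_def
proof (intro ballI)
  fix a b assume "a \<in> X" "b \<in> - X"
  then show "0 < lift X N g a b" using assms[of a b] by (simp add: lift_def)
qed

context margin_rule
begin

lemma lift_eq: "skew g \<Longrightarrow> G g = X \<Longrightarrow> G (lift X N g) = X"
  by (rule weaken_outside[of g]) (auto simp: skew_lift, auto simp: lift_def)

text \<open>With strict bounds the induction on \<open>n\<close> starts vacuously;
  \<open>choice_below\<close> is the same claim indexed by the size of the choice set.\<close>

definition tc_below :: "nat \<Rightarrow> bool" where
  "tc_below n \<longleftrightarrow> (\<forall>g V. skew g \<longrightarrow> is_tc g V \<longrightarrow> card V < n \<longrightarrow> G g = V)"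

definition choice_below :: "nat \<Rightarrow> bool" where
  "choice_below n \<longleftrightarrow> (\<forall>g. skew g \<longrightarrow> card (G g) < n \<longrightarrow> is_tc g (G g))"

text \<open>Once \<open>v\<close> loses to everyone, \<open>V - {v}\<close> is dominant, so the top
  cycle has fewer than \<open>n\<close> elements and is chosen. As \<open>v\<close> was not chosen,
  weakening it changes neither the choice set nor the margins inside it.\<close>

lemma push_down:
  assumes n: "tc_below n" and g: "skew g" and V: "dominates g V (- V)" "card V \<le> n"
    and v: "v \<in> V" "v \<notin> G g" "V \<noteq> {v}"
  shows "G g \<subseteq> V - {v}" "strong g (G g)"
proof -
  obtain N :: nat where N: "\<And>a b. \<bar>g a b\<bar> < int N" using ex_bound by blast
  \<comment> \<open>Against \<open>G g\<close> the gain \<open>N\<close> must be uniform; the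
    margins of unchosen alternatives over \<open>v\<close> may simply be set to 1.\<close>
  define h where "h = (\<lambda>a b. if a = v \<and> b = v then 0
      else if b = v then (if a \<in> G g then g a v + int N else 1)
      else if a = v then - (if b \<in> G g then g b v + int N else 1) else g a b)"
  have sk: "skew h" using skewD[OF g] by (auto simp: skew_def h_def)
  have pos: "0 < h a v" if "a \<noteq> v" for a
    using that N[of a v] by (auto simp: h_def)
  have eq: "h a b = g a b" if "a \<noteq> v" "b \<noteq> v" for a b using that by (simp add: h_def)
  have Gh: "G h = G g"
  proof (rule weaken_outside[OF g sk refl])
    fix u assume u: "u \<notin> G g"
    show "\<exists>n. \<forall>a\<in>G g. h a u = g a u + int n"
    proof (cases "u = v")
      case True
      then have "\<forall>a\<in>G g. h a u = g a u + int N" using v by (auto simp: h_def)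
      then show ?thesis ..
    next
      case False
      then have "\<forall>a\<in>G g. h a u = g a u + int 0" using v by (auto simp: h_def)
      then show ?thesis ..
    qed
  next
    fix a b assume "a \<in> G g" "b \<in> G g"
    then show "h a b = g a b" using v(2) eq by metis
  qed
  have dom: "dominates h (V - {v}) (- (V - {v}))"
    unfolding dominates_def
  proof (intro ballI)
    fix a b assume "a \<in> V - {v}" "b \<in> - (V - {v})"
    then show "0 < h a b"
      using pos[of a] eq[of a b] dominatesD[OF V(1), of a b] by (cases "b = v") auto
  qed
  have "V - {v} \<noteq> {}" using v by blast
  from tc_exists_subset[OF dom this] obtain W where W: "is_tc h W" "W \<subseteq> V - {v}" by blast
  have "W \<subset> V" using W v by blast
  then have "card W < n" using V(2) by (meson finite psubset_card_mono less_le_trans)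
  then have "G h = W" using n sk W unfolding tc_below_def by blast
  then have W': "W = G g" using Gh by simp
  show "G g \<subseteq> V - {v}" using W W' by blast
  have "strong h (G g)" using W W' by (simp add: is_tc_def)
  then show "strong g (G g)"
    by (rule strong_mono[OF sk g]) (use eq v in metis)
qed

text \<open>\<open>V\<close> stays the top cycle along the path and no outsider gains on it, so a
  changed choice set would lack some \<open>v \<in> V\<close>. By \<open>push_down\<close> it would
  be smaller than \<open>V\<close>, and \<open>choice_below\<close> would make it a second top
  cycle.\<close>

lemma tc_path:
  assumes m: "tc_below m" "choice_below m"
    and g: "skew g" and h: "skew h" and V: "G g = V" "card V = m"
    and up: "\<And>v u. v \<in> V \<Longrightarrow> u \<notin> V \<Longrightarrow> 0 < g v u \<and> g v u \<le> h v u"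
    and st: "\<And>k. skew k \<Longrightarrow> between g h k \<Longrightarrow> strong k V"
  shows "G h = V"
  using g h V(1)
proof (induction rule: path_induct)
  case (step k y x)
  define k' where "k' = inc y x k"
  have sk: "skew k'" using step(1) by (simp add: k'_def)
  have "V \<noteq> {}" using V ne[OF g] by simp
  moreover have "0 < k' v u" if "v \<in> V" "u \<notin> V" for v u
    using betweenD[OF step(3), of v u] up[OF that] by (simp add: k'_def)
  ultimately have tc: "is_tc k' V"
    using st[OF sk] step(3) by (auto simp: is_tc_def k'_def dominates_def)
  have notup: "\<not> (y \<notin> V \<and> x \<in> V)"
  proof
    assume "y \<notin> V \<and> x \<in> V"
    then have "h y x \<le> g y x" using up[of x y] skewD[OF g, of x y] skewD[OF h, of x y] by simp
    then show False using betweenD[OF step(2), of y x] step(5) by simp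
  qed
  have "G k' = V"
  proof (rule ccontr)
    assume ne: "G k' \<noteq> V"
    have "y \<in> V \<inter> G k' \<and> x \<in> V - G k' \<or> y \<in> V - G k' \<and> V \<inter> G k' \<noteq> {}"
      using transition[OF step(1) step(6)[symmetric] step(7) refl] ne notup
      unfolding k'_def by auto
    then have "\<exists>v. v \<in> V \<and> v \<notin> G k' \<and> V \<noteq> {v}"
    proof
      assume "y \<in> V \<inter> G k' \<and> x \<in> V - G k'"
      then show ?thesis by (intro exI[of _ x]) auto
    next
      assume "y \<in> V - G k' \<and> V \<inter> G k' \<noteq> {}"
      then show ?thesis by (intro exI[of _ y]) auto
    qed
    then obtain v where v: "v \<in> V" "v \<notin> G k'" "V \<noteq> {v}" by blast
    have "dominates k' V (- V)" using tc by (simp add: is_tc_def)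
    from push_down(1)[OF m(1) sk this _ v] V(2) have "G k' \<subseteq> V - {v}" by simp
    then have "G k' \<subset> V" using v(1) by blast
    then have "card (G k') < m" using V(2) by (metis finite psubset_card_mono)
    then have "is_tc k' (G k')" using m(2) sk unfolding choice_below_def by blast
    then show False using tc_unique[OF sk tc] ne by blast
  qed
  then show ?case by (simp add: k'_def)
qed

text \<open>After lifting, the choice set is dominant and contains the top cycle; a strictly smaller
  top cycle would itself be chosen. Lifting does not touch the margins inside the choice
  set.\<close>

lemma choice_strong:
  assumes m: "tc_below m" and g: "skew g" and X: "card (G g) \<le> m"
  shows "strong g (G g)"
proof -
  obtain N :: nat where N: "\<And>a b. \<bar>g a b\<bar> < int N" using ex_bound by blast
  define h where "h = lift (G g) N g"
  have sk: "skew h" by (simp add: h_def skew_lift g)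
  have Gh: "G h = G g" unfolding h_def by (rule lift_eq[OF g refl])
  have "dominates h (G g) (- G g)" unfolding h_def by (rule lift_dominates[OF N])
  from tc_exists_subset[OF this ne[OF g]] obtain W where W: "is_tc h W" "W \<subseteq> G g" by blast
  have "W = G g"
  proof (rule ccontr)
    assume "W \<noteq> G g"
    then have "card W < m" using W X by (metis finite psubset_card_mono psubsetI less_le_trans)
    then show False using m sk W Gh \<open>W \<noteq> G g\<close> unfolding tc_below_def by blast
  qed
  then have "strong h (G g)" using W by (simp add: is_tc_def)
  then show ?thesis
    by (rule strong_mono[OF sk g]) (auto simp: h_def lift_def)
qed

lemma tc_below_Suc:
  assumes m: "tc_below m" "choice_below m"
  shows "tc_below (Suc m)"
  unfolding tc_below_def
proof (intro allI impI)
  fix g :: "'a \<Rightarrow> 'a \<Rightarrow> int" and V assume g: "skew g" and tc: "is_tc g V" and "card V < Suc m"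
  show "G g = V"
  proof (cases "card V < m")
    case True
    then show ?thesis using m(1) g tc unfolding tc_below_def by blast
  next
    case False
    with \<open>card V < Suc m\<close> have card: "card V = m" by simp
    have "V \<noteq> {}" using tc by (simp add: is_tc_def)
    then obtain g0 where g0: "skew g0" "G g0 = V" using onto by blast
    obtain N :: nat where N: "\<And>a b. \<bar>g0 a b\<bar> < int N" using ex_bound by blast
    define h where "h = lift V N g0"
    have sk: "skew h" by (simp add: h_def skew_lift g0)
    have Gh: "G h = V" unfolding h_def by (rule lift_eq[OF g0])
    have dom: "dominates h V (- V)" unfolding h_def by (rule lift_dominates[OF N])
    have str: "strong h V" using choice_strong[OF m(1) sk] Gh card by simp
    \<comment> \<open>Scaling \<open>g\<close> by \<open>M\<close> puts its margins from
      \<open>V\<close> to the outside above those of \<open>h\<close>, so no outsider gains on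
      \<open>V\<close>; \<open>hom\<close> removes the factor at the end.\<close>
    obtain M :: nat where M: "\<And>a b. \<bar>h a b\<bar> < int M" using ex_bound by blast
    have M0: "0 < M" using M[of undefined undefined] by simp
    define tgt where "tgt = (\<lambda>a b. int M * g a b)"
    have skt: "skew tgt"
      using skewD[OF g] unfolding skew_def tgt_def by (metis distrib_left mult_zero_right)
    \<comment> \<open>Inside \<open>V\<close> everything is first brought to ties. From
      \<open>h\<close> to \<open>mid\<close> the non-negative margins of \<open>h\<close> inside
      \<open>V\<close> stay non-negative, and from \<open>mid\<close> to \<open>tgt\<close> those of
      \<open>g\<close> do, so \<open>V\<close> stays strong on both legs.\<close>
    define mid where "mid = (\<lambda>a b. if a \<in> V \<and> b \<in> V then 0 else tgt a b)"
    have skm: "skew mid" using skewD[OF skt] by (auto simp: skew_def mid_def)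
    have up: "0 < h v u \<and> h v u \<le> tgt v u" if "v \<in> V" "u \<notin> V" for v u
    proof -
      have "1 \<le> g v u" using tc that by (force simp: is_tc_def dominates_def)
      then have "int M * 1 \<le> tgt v u" unfolding tgt_def by (intro mult_left_mono) auto
      then show ?thesis using M[of v u] dominatesD[OF dom, of v u] that by simp
    qed
    have "G mid = V"
    proof (rule tc_path[OF m sk skm Gh card])
      fix k assume k: "skew k" "between h mid k"
      show "strong k V"
      proof (rule strong_mono[OF sk k(1) str])
        fix a b assume "a \<in> V" "b \<in> V" "0 \<le> h a b"
        then show "0 \<le> k a b" using betweenD[OF k(2), of a b] by (simp add: mid_def)
      qed
    qed (use up in \<open>simp add: mid_def\<close>)
    then have "G tgt = V"
    proof (rule tc_path[OF m skm skt _ card])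
      fix k assume k: "skew k" "between mid tgt k"
      have "strong g V" using tc by (simp add: is_tc_def)
      then show "strong k V"
      proof (rule strong_mono[OF g k(1)])
        fix a b assume "a \<in> V" "b \<in> V" "0 \<le> g a b"
        then show "0 \<le> k a b" using betweenD[OF k(2), of a b] by (simp add: mid_def tgt_def)
      qed
    qed (use up in \<open>force simp: mid_def\<close>)
    then show ?thesis using hom[OF g, of M] M0 by (simp add: tgt_def)
  qed
qed

text \<open>In a matrix with choice set \<open>{w, z}\<close> these two must tie. If
  \<open>g w z \<le> 0\<close>, a suitably lifted matrix of this kind arises from \<open>g\<close>
  by weakening the alternatives outside \<open>{w}\<close>, which would keep the choice
  \<open>{w}\<close>.\<close>

lemma singleton_choice_dominates:
  assumes two: "tc_below 2" and g: "skew g" and X: "G g = {w}"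
  shows "dominates g {w} (- {w})"
proof (rule ccontr)
  assume "\<not> ?thesis"
  then obtain z where z: "z \<noteq> w" "g w z \<le> 0" by (force simp: dominates_def)
  obtain g0 where g0: "skew g0" "G g0 = {w, z}" using onto[of "{w, z}"] by blast
  obtain N0 :: nat where N0: "\<And>a b. \<bar>g0 a b\<bar> < int N0" using ex_bound by blast
  obtain N1 :: nat where N1: "\<And>a b. \<bar>g a b\<bar> < int N1" using ex_bound by blast
  define h where "h = lift {w, z} (N0 + N1) g0"
  have sk: "skew h" by (simp add: h_def skew_lift g0)
  have Gh: "G h = {w, z}" unfolding h_def by (rule lift_eq[OF g0])
  have "strong h {w, z}" using choice_strong[OF two sk] Gh z by simp
  then have "\<not> dominates h {w} {z}" "\<not> dominates h {z} {w}"
    using not_strong[of "{w}" "{w, z}" h] not_strong[of "{z}" "{w, z}" h] z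
    by (auto simp: insert_Diff_if)
  then have tie: "h w z = 0" using skewD[OF sk, of w z] by (auto simp: dominates_def)
  have "G h = {w}"
  proof (rule weaken_outside[OF g sk X])
    fix u assume u: "u \<notin> {w}"
    have "g w u \<le> h w u"
      using tie z N0[of w u] N1[of w u] u by (cases "u = z") (auto simp: h_def lift_def)
    then show "\<exists>n. \<forall>a\<in>{w}. h a u = g a u + int n"
      by (intro exI[of _ "nat (h w u - g w u)"]) simp
  qed (use skew_diag[OF sk] skew_diag[OF g] in auto)
  then show False using Gh z by auto
qed

end

text \<open>Endpoint of a path that raises only pairs of \<open>A\<close>: their margins below
  \<open>t\<close> are lifted to \<open>t\<close>, larger ones are kept.\<close>

definition force :: "('a \<times> 'a) set \<Rightarrow> int \<Rightarrow> ('a \<Rightarrow> 'a \<Rightarrow> int) \<Rightarrow> 'a \<Rightarrow> 'a \<Rightarrow> int" where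
  "force A t g = (\<lambda>a b. if (a, b) \<in> A then max t (g a b)
     else if (b, a) \<in> A then - max t (g b a) else g a b)"

lemma skew_force: "skew g \<Longrightarrow> A \<inter> A\<inverse> = {} \<Longrightarrow> skew (force A t g)"
  unfolding skew_def force_def by auto

lemma force_in: "(a, b) \<in> A \<Longrightarrow> t \<le> force A t g a b"
  by (simp add: force_def)

lemma force_out: "(a, b) \<notin> A \<Longrightarrow> (b, a) \<notin> A \<Longrightarrow> force A t g a b = g a b"
  by (simp add: force_def)

lemma between_force_out:
  "between g (force A t g) k \<Longrightarrow> (a, b) \<notin> A \<Longrightarrow> (b, a) \<notin> A \<Longrightarrow> k a b = g a b"
  using betweenD[of g "force A t g" k a b] by (simp add: force_out)

lemma between_force_in: "between g (force A t g) k \<Longrightarrow> (a, b) \<in> A \<Longrightarrow> g a b \<le> k a b"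
  using betweenD[of g "force A t g" k a b] by (simp add: force_def)

text \<open>A reversed pair of \<open>A\<close> never gains on the way to
  \<open>force A t g\<close>, so every raise along the path is a pair of \<open>A\<close> still
  below \<open>t\<close>.\<close>

lemma force_step:
  assumes "skew g" "g y x \<le> n" "n < force A t g y x"
  shows "(y, x) \<in> A" "n < t"
  using assms skewD[OF assms(1), of x y] by (auto simp: force_def split: if_splits)

text \<open>The edges from \<open>p\<close> to \<open>z\<close>, from \<open>z\<close> to
  \<open>w\<close> and from \<open>w\<close> to \<open>q\<close> attach \<open>z\<close> and
  \<open>w\<close> to \<open>Q\<close>; a cut that does not split \<open>Q\<close> is crossed by one
  of them.\<close>

lemma strong_pendant:
  assumes g: "skew g" and Q: "strong g Q" and "q \<in> Q" "0 \<le> g w q" "p \<in> Q" "0 \<le> g p z" "0 \<le> g z w"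
  shows "strong g (insert z (insert w Q))"
proof (rule strongI[OF g])
  let ?V = "insert z (insert w Q)"
  fix S assume S: "S \<noteq> {}" "S \<subset> ?V"
  show "\<exists>a\<in>?V - S. \<exists>b\<in>S. 0 \<le> g a b"
  proof (cases "S \<inter> Q \<noteq> {} \<and> S \<inter> Q \<subset> Q")
    case True
    then obtain a b where "a \<in> Q - S \<inter> Q" "b \<in> S \<inter> Q" "0 \<le> g a b"
      using strong_cut[OF g Q, of "S \<inter> Q"] by blast
    then show ?thesis by blast
  next
    case False
    then consider "Q \<subseteq> S" "w \<notin> S" | "Q \<subseteq> S" "w \<in> S" | "S \<inter> Q = {}" "z \<in> S" | "S \<inter> Q = {}" "z \<notin> S"
      by blast
    then show ?thesis
    proof cases
      case 1 then show ?thesis using assms(3,4) by blast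
    next
      case 2 then show ?thesis using assms(7) S by blast
    next
      case 3 then show ?thesis using assms(5,6) by blast
    next
      case 4 then show ?thesis using assms(7) S by blast
    qed
  qed
qed

section \<open>Critical sets: top cycles of size \<open>m + 1\<close> with one alternative
  excluded\<close>

locale critical = margin_rule +
  fixes m and V :: "'a set"
  assumes tcb: "tc_below (Suc m)" and chb: "choice_below m"
    and card_V: "card V = Suc m" and m2: "2 \<le> m"
begin

lemma card_minus: "c \<in> V \<Longrightarrow> card (V - {c}) = m"
  using card_V by simp

text \<open>\<open>push_down\<close> confines the choice set to \<open>V - {v}\<close>; a proper
  subset would have fewer than \<open>m\<close> elements and be another top cycle.\<close>

lemma excluded:
  assumes k: "skew k" "is_tc k V" and v: "v \<in> V" "v \<notin> G k"
  shows "G k = V - {v}"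
proof -
  have "V \<noteq> {v}" using card_V m2 by auto
  then have sub: "G k \<subseteq> V - {v}"
    using push_down(1)[OF tcb k(1) _ _ v] k(2) card_V by (simp add: is_tc_def)
  show ?thesis
  proof (rule ccontr)
    assume "G k \<noteq> V - {v}"
    then have "card (G k) < m"
      using sub card_minus[OF v(1)] by (metis finite psubset_card_mono psubsetI)
    then have "is_tc k (G k)" using chb k(1) unfolding choice_below_def by blast
    then show False using tc_unique[OF k(1,2)] v by blast
  qed
qed

lemma strong_minus:
  assumes "skew k" "c \<in> V" "G k = V - {c}"
  shows "strong k (V - {c})"
  using choice_strong[OF tcb assms(1)] assms(3) card_minus[OF assms(2)] by simp

text \<open>When the raised \<open>y\<close> is not the excluded \<open>u\<close>,
  \<open>transition\<close> leaves only the loss of \<open>x\<close>, or the loss of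
  \<open>y\<close> in exchange for \<open>x\<close>. By \<open>excluded\<close>, whichever is lost
  becomes the only excluded alternative.\<close>

lemma exclusion_step:
  assumes k: "skew k" and tc: "is_tc (inc y x k) V"
    and xy: "x \<in> V" "y \<in> V" "y \<noteq> x" and u: "u \<in> V" "G k = V - {u}" "y \<noteq> u"
  shows "G (inc y x k) = V - {u} \<or> G (inc y x k) = V - {x} \<or> x = u \<and> G (inc y x k) = V - {y}"
proof (cases "G (inc y x k) = V - {u}")
  case False
  have sk: "skew (inc y x k)" using k by simp
  let ?X = "G (inc y x k)"
  have "y \<in> V - {u}" using xy u by blast
  then consider "x \<in> (V - {u}) - ?X" | "y \<in> (V - {u}) - ?X" "x \<in> ?X - (V - {u})"
    using transition[OF k xy(3)[symmetric] u(2) refl False] by blast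
  then show ?thesis
  proof cases
    case 1
    then show ?thesis using excluded[OF sk tc, of x] by blast
  next
    case 2
    then show ?thesis using excluded[OF sk tc, of y] xy by blast
  qed
qed simp

text \<open>\<open>V - {z, w}\<close> is non-empty because \<open>V\<close> has at least three
  elements, and it dominates \<open>z\<close>, the rest of \<open>V - {w}\<close>.\<close>

lemma not_strong_minus_w:
  assumes "z \<in> V" "w \<in> V" "z \<noteq> w" "\<And>q. q \<in> V - {z, w} \<Longrightarrow> 0 < k q z"
  shows "\<not> strong k (V - {w})"
proof (rule not_strong)
  have "card {z, w} < card V" using card_V m2 assms(3) by simp
  then have "V \<noteq> {z, w}" by auto
  then show "V - {z, w} \<noteq> {}" using assms by blast
  show "V - {z, w} \<subset> V - {w}" using assms by blast
  show "dominates k (V - {z, w}) (V - {w} - (V - {z, w}))"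
    using assms(4) unfolding dominates_def by blast
qed

lemma not_excluded_w:
  assumes "z \<in> V" "w \<in> V" "z \<noteq> w" "\<And>q. q \<in> V - {z, w} \<Longrightarrow> 0 < k q z" "skew k"
  shows "G k \<noteq> V - {w}"
  using not_strong_minus_w[OF assms(1-3), where k = k] assms(4) strong_minus[OF assms(5,2)] by blast

text \<open>First \<open>w\<close> is raised over all of \<open>Q\<close>, which expels \<open>z\<close> as the excluded alternative; then everything but
  the excluded \<open>c\<close> is raised over \<open>w\<close>. The excluded alternative is never \<open>w\<close>, so it stays \<open>c\<close>, although
  \<open>V - {c}\<close> finally has the dominant subset \<open>V - {c, w}\<close>.\<close>

lemma pendant_contradiction:
  assumes g: "skew g" and dom: "dominates g V (- V)"
    and zw: "z \<in> V" "w \<in> V" "z \<noteq> w" "g z w = 0" and Q: "Q = V - {z, w}"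
    and Qz: "\<And>q. q \<in> Q \<Longrightarrow> 0 < g q z" and str: "strong g Q" and q0: "q0 \<in> Q" "0 \<le> g w q0"
    and c: "c \<in> V" "G g = V - {c}"
  shows False
proof -
  have V: "V = insert z (insert w Q)" using zw Q by blast
  have ne: "V \<noteq> {}" using zw by blast
  \<comment> \<open>All of \<open>Q\<close> beats \<open>z\<close>, \<open>z\<close> at least ties
    \<open>w\<close>, and \<open>w\<close> at least ties some \<open>q\<close>: this cycle keeps
    \<open>V\<close> strong.\<close>
  have tc: "is_tc k V"
    if "skew k" "dominates k V (- V)" "strong k Q" "0 \<le> k w q" "q \<in> Q" "\<And>q. q \<in> Q \<Longrightarrow> 0 < k q z" "0 \<le> k z w"
    for k q
    using strong_pendant[OF that(1,3,5,4,5) _ that(7)] that(2) that(6)[OF that(5)] ne V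
    by (simp add: is_tc_def)
  define h where "h = force ({w} \<times> Q) 1 g"
  have skh: "skew h" unfolding h_def by (rule skew_force[OF g]) (use Q in auto)
  have same: "k a b = g a b" if "between g h k" "a \<in> Q \<or> a = z \<or> a \<notin> V" "b \<noteq> w \<or> a \<notin> Q" for k a b
  proof (rule between_force_out[OF that(1)[unfolded h_def]])
    show "(a, b) \<notin> {w} \<times> Q" "(b, a) \<notin> {w} \<times> Q" using that(2,3) zw Q by blast+
  qed
  have ktc: "is_tc k V" if k: "skew k" "between g h k" for k
  proof (rule tc[OF k(1) _ _ _ q0(1)])
    show "dominates k V (- V)"
      unfolding dominates_def
    proof (intro ballI)
      fix a b assume ab: "a \<in> V" "b \<in> - V"
      then have "k a b = g a b"
        using between_force_out[OF k(2)[unfolded h_def], of a b] Q zw by auto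
      then show "0 < k a b" using dominatesD[OF dom ab] by simp
    qed
    show "strong k Q" by (rule strong_mono[OF g k(1) str]) (use same[OF k(2)] Q in auto)
    show "0 \<le> k w q0" using between_force_in[OF k(2)[unfolded h_def], of w q0] q0 by simp
    show "0 < k q z" if "q \<in> Q" for q using same[OF k(2), of q z] Qz that zw by simp
    show "0 \<le> k z w" using same[OF k(2), of z w] zw Q by simp
  qed
  have "c \<noteq> w" using not_excluded_w[OF zw(1-3) _ g] Qz c Q by blast
  then have "\<exists>c\<in>V - {w}. G g = V - {c}" using c by blast
  with g skh have "\<exists>c\<in>V - {w}. G h = V - {c}"
  proof (induction rule: path_induct)
    case (step k y x)
    then obtain u where u: "u \<in> V - {w}" "G k = V - {u}" by blast
    have yx: "y = w" "x \<in> Q" using force_step(1)[OF g step(4)] step(5) unfolding h_def by auto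
    have sk: "skew (inc y x k)" using step(1) by simp
    have "G (inc y x k) \<noteq> V - {w}"
      by (rule not_excluded_w[OF zw(1-3) _ sk]) (use same[OF step(3)] Qz Q zw in auto)
    then have "G (inc y x k) = V - {u} \<or> G (inc y x k) = V - {x}"
      using exclusion_step[OF step(1) ktc[OF sk step(3)], of u] yx u Q zw by blast
    then show ?case using u yx Q by blast
  qed
  then obtain c where c: "c \<in> V" "c \<noteq> w" "G h = V - {c}" by blast
  have bh: "between g h h" by (simp add: between_def)
  have hw: "0 < h w q" if "q \<in> Q" for q
    using force_in[of w q "{w} \<times> Q" 1 g] that by (simp add: h_def)
  \<comment> \<open>Now \<open>w\<close> dominates \<open>Q\<close>, so \<open>V - {z}\<close> is
    not strong and cannot be the choice set.\<close>
  have "c \<noteq> z"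
  proof
    assume "c = z"
    then have "strong h (V - {z})" using strong_minus[OF skh c(1,3)] by simp
    moreover have "\<not> strong h (V - {z})"
      by (rule not_strong[of "{w}"]) (use zw q0 Q hw in \<open>auto simp: dominates_def\<close>)
    ultimately show False by blast
  qed
  then have cQ: "c \<in> Q" using c Q by blast
  \<comment> \<open>\<open>c\<close> is left out because \<open>exclusion_step\<close> does not
    cover raises of the excluded alternative. As a result \<open>w\<close> still beats
    \<open>c\<close>, which keeps \<open>V\<close> strong along the path.\<close>
  define A where "A = (V - {w, c}) \<times> {w}"
  define h' where "h' = force A 1 h"
  have skh': "skew h'" unfolding h'_def by (rule skew_force[OF skh]) (auto simp: A_def)
  have out: "k a b = h a b" if "between h h' k" "(a, b) \<notin> A" "(b, a) \<notin> A" for k a b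
    using between_force_out[OF that(1)[unfolded h'_def]] that(2,3) by blast
  have kQz: "0 < k q z" if "between h h' k" "q \<in> Q" for k q
    using out[OF that(1), of q z] same[OF bh, of q z] Qz[OF that(2)] that(2) zw Q by (auto simp: A_def)
  have ktc': "is_tc k V" if k: "skew k" "between h h' k" for k
  proof (rule tc[OF k(1) _ _ _ cQ])
    have "dominates h V (- V)" using ktc[OF skh bh] by (simp add: is_tc_def)
    moreover have "k a b = h a b" if "a \<in> V" "b \<in> - V" for a b
      by (rule out[OF k(2)]) (use that zw in \<open>auto simp: A_def\<close>)
    ultimately show "dominates k V (- V)" unfolding dominates_def by simp
    have "strong h Q" by (rule strong_mono[OF g skh str]) (use same[OF bh] Q in auto)
    then show "strong k Q"
      by (rule strong_mono[OF skh k(1)]) (use out[OF k(2)] Q in \<open>auto simp: A_def\<close>)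
    show "0 \<le> k w c" using out[OF k(2), of w c] hw[OF cQ] by (auto simp: A_def)
    show "0 < k q z" if "q \<in> Q" for q using kQz[OF k(2) that] .
    have "h z w \<le> k z w"
      using between_force_in[OF k(2)[unfolded h'_def], of z w] zw \<open>c \<noteq> z\<close> by (auto simp: A_def)
    then show "0 \<le> k z w" using same[OF bh, of z w] zw Q by simp
  qed
  from skh skh' c(3) have "G h' = V - {c}"
  proof (induction rule: path_induct)
    case (step k y x)
    have yx: "y \<in> V - {w, c}" "x = w"
      using force_step(1)[OF skh step(4)] step(5) unfolding h'_def A_def by auto
    have sk: "skew (inc y x k)" using step(1) by simp
    have "G (inc y x k) \<noteq> V - {w}"
      by (rule not_excluded_w[OF zw(1-3) _ sk]) (use kQz[OF step(3)] Q in auto)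
    then show ?case
      using exclusion_step[OF step(1) ktc'[OF sk step(3)], of c] yx c step(7) zw by blast
  qed
  then have "strong h' (V - {c})" using strong_minus[OF skh' c(1)] by simp
  moreover have "\<not> strong h' (V - {c})"
  proof (rule not_strong[of "V - {w, c}"])
    show "dominates h' (V - {w, c}) (V - {c} - (V - {w, c}))"
      unfolding dominates_def
    proof (intro ballI)
      fix a b assume "a \<in> V - {w, c}" "b \<in> V - {c} - (V - {w, c})"
      then have "(a, b) \<in> A" by (auto simp: A_def)
      then show "0 < h' a b" using force_in[of a b A 1 h] by (simp add: h'_def)
    qed
  qed (use zw c \<open>c \<noteq> z\<close> in auto)
  ultimately show False by blast
qed

end

section \<open>Tied pairs without the strength of \<open>V - {z, w}\<close>\<close>

context critical
begin

text \<open>Since \<open>c\<close> loses to the rest of \<open>Q\<close>, it can take the role of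
  \<open>z\<close>, and \<open>z\<close> that of \<open>w\<close>, in
  \<open>pendant_contradiction\<close>. The margins of \<open>w\<close> are first adjusted so that
  \<open>V - {c, z}\<close> becomes strong and beats \<open>c\<close>; then \<open>c\<close> is
  weakened to a tie with \<open>z\<close>.\<close>

lemma tie_contradiction_zeroed:
  assumes g: "skew g" and dom: "dominates g V (- V)"
    and zw: "z \<in> V" "w \<in> V" "z \<noteq> w" "g z w = 0" and Q: "Q = V - {z, w}"
    and Qz: "\<And>q. q \<in> Q \<Longrightarrow> 0 < g q z" and str: "strong g V"
    and c: "c \<in> Q" "G g = V - {c}" and Q0: "Q \<noteq> {c}"
    and zero: "\<And>x y. x \<in> Q - {c} \<Longrightarrow> y \<in> Q - {c} \<Longrightarrow> g x y = 0"
    and Qc: "\<And>q. q \<in> Q - {c} \<Longrightarrow> 0 < g q c"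
  shows False
proof -
  have cV: "c \<in> V" "c \<noteq> z" "c \<noteq> w" using c Q by auto
  have strc: "strong g (V - {c})" by (rule strong_minus[OF g cV(1) c(2)])
  \<comment> \<open>Strength of \<open>V - {c}\<close> gives an edge into \<open>Q - {c}\<close>,
    which must leave from \<open>w\<close> because \<open>z\<close> loses to
    \<open>Q\<close>.\<close>
  obtain b0 where b0: "b0 \<in> Q - {c}" "0 \<le> g w b0"
  proof -
    have "Q - {c} \<noteq> {}" using Q0 c by blast
    moreover have "Q - {c} \<subset> V - {c}" using Q zw cV by blast
    ultimately obtain a b where ab: "a \<in> (V - {c}) - (Q - {c})" "b \<in> Q - {c}" "0 \<le> g a b"
      by (rule strong_cut[OF g strc])
    have "a = w"
    proof (rule ccontr)
      assume "a \<noteq> w"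
      then have "a = z" using ab Q by blast
      then show False using ab(2,3) Qz[of b] skewD[OF g, of z b] by simp
    qed
    then show ?thesis using ab that by blast
  qed
  have b0': "b0 \<in> V" "b0 \<noteq> c" "b0 \<noteq> z" "b0 \<noteq> w" using b0 Q by auto
  \<comment> \<open>\<open>h1\<close> ties \<open>w\<close> with \<open>b0\<close>, and
    \<open>h\<close> then lets \<open>w\<close> beat \<open>c\<close>. Both raise alternatives other
    than \<open>c\<close>, and \<open>w\<close> cannot become excluded, so \<open>c\<close> stays
    excluded.\<close>
  define h1 where "h1 = force {(b0, w)} 0 g"
  define h where "h = force {(w, c)} 1 h1"
  have sk1: "skew h1" unfolding h1_def by (rule skew_force[OF g]) (use b0' in auto)
  have sk: "skew h" unfolding h_def by (rule skew_force[OF sk1]) (use cV in auto)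
  have h1w: "h1 w b0 = 0" "h1 b0 w = 0"
    using b0 b0' skewD[OF g, of w b0] by (auto simp: h1_def force_def)
  have out1: "k a b = g a b" if "between g h1 k" "(a, b) \<noteq> (b0, w)" "(a, b) \<noteq> (w, b0)" for k a b
    using between_force_out[OF that(1)[unfolded h1_def], of a b] that(2,3) by auto
  have out: "k a b = h1 a b" if "between h1 h k" "(a, b) \<noteq> (w, c)" "(a, b) \<noteq> (c, w)" for k a b
    using between_force_out[OF that(1)[unfolded h_def], of a b] that(2,3) by auto
  have bt: "between k k' k" "between k k' k'" for k k' :: "'a \<Rightarrow> 'a \<Rightarrow> int"
    by (auto simp: between_def)
  have strc1: "strong k (V - {c})" if k: "skew k" "between g h1 k" for k
  proof (rule strong_mono[OF g k(1) strc])
    fix a b assume "0 \<le> g a b"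
    moreover have "min (g a b) (h1 a b) \<le> k a b" using betweenD[OF k(2)] by blast
    moreover have "0 \<le> g a b \<longrightarrow> 0 \<le> h1 a b"
      using b0(2) b0' h1w out1[OF bt(2), of a b] by (cases "(a, b) = (b0, w) \<or> (a, b) = (w, b0)") auto
    ultimately show "0 \<le> k a b" by linarith
  qed
  have strc2: "strong k (V - {c})" if k: "skew k" "between h1 h k" for k
    by (rule strong_mono[OF sk1 k(1) strc1[OF sk1 bt(2)]]) (use out[OF k(2)] in auto)
  have tc: "is_tc k V"
    if k: "skew k" "strong k (V - {c})" "\<And>a b. a \<notin> {b0, c} \<or> b \<noteq> w \<Longrightarrow> a \<noteq> w \<or> b \<notin> {b0, c} \<Longrightarrow> k a b = g a b" for k
  proof -
    have "0 \<le> k b0 c" using k(3)[of b0 c] b0' cV Qc[OF b0(1)] by simp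
    moreover have "0 \<le> k c z" using k(3)[of c z] zw cV Qz[OF c(1)] by simp
    ultimately have "strong k (insert c (V - {c}))"
      using strong_insert[OF k(1,2), of b0 c z] b0' cV zw by blast
    then have "strong k V" using cV by (simp add: insert_absorb)
    moreover have "k a b = g a b" if "a \<in> V" "b \<in> - V" for a b
      using k(3)[of a b] that b0' cV zw by auto
    then have "dominates k V (- V)" using dom unfolding dominates_def by simp
    ultimately show ?thesis using zw by (auto simp: is_tc_def)
  qed
  have tc1: "is_tc k V" if k: "skew k" "between g h1 k" for k
    by (rule tc[OF k(1) strc1[OF k]]) (use out1[OF k(2)] in auto)
  have tc2: "is_tc k V" if k: "skew k" "between h1 h k" for k
  proof (rule tc[OF k(1) strc2[OF k]])
    fix a b assume ab: "a \<notin> {b0, c} \<or> b \<noteq> w" "a \<noteq> w \<or> b \<notin> {b0, c}"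
    have "k a b = h1 a b" by (rule out[OF k(2)]) (use ab in auto)
    also have "\<dots> = g a b" by (rule out1[OF bt(2)]) (use ab in auto)
    finally show "k a b = g a b" .
  qed
  have Qz1: "0 < k q z" if "between g h1 k" "q \<in> V - {z, w}" for k q
    using out1[OF that(1), of q z] that(2) zw Qz[of q] Q by auto
  have Qz2: "0 < k q z" if "between h1 h k" "q \<in> V - {z, w}" for k q
    using out[OF that(1), of q z] Qz1[OF bt(2), of q] that(2) zw cV by auto
  from g sk1 c(2) have G1: "G h1 = V - {c}"
  proof (induction rule: path_induct)
    case (step k y x)
    have yx: "y = b0" "x = w"
      using force_step(1)[OF g step(4)] step(5) unfolding h1_def by auto
    have sk: "skew (inc y x k)" using step(1) by simp
    have "G (inc y x k) \<noteq> V - {w}"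
      by (rule not_excluded_w[OF zw(1-3) _ sk]) (use Qz1[OF step(3)] in blast)
    then show ?case
      using exclusion_step[OF step(1) tc1[OF sk step(3)], of c] yx b0' cV zw step(7) by blast
  qed
  from sk1 sk G1 have Gh: "G h = V - {c}"
  proof (induction rule: path_induct)
    case (step k y x)
    have yx: "y = w" "x = c"
      using force_step(1)[OF sk1 step(4)] step(5) unfolding h_def by auto
    have sk: "skew (inc y x k)" using step(1) by simp
    have "G (inc y x k) \<noteq> V - {w}"
      by (rule not_excluded_w[OF zw(1-3) _ sk]) (use Qz2[OF step(3)] in blast)
    then show ?case
      using exclusion_step[OF step(1) tc2[OF sk step(3)], of c] yx cV zw step(7) by blast
  qed
  have hg: "h a b = g a b" if "a \<notin> {b0, c} \<or> b \<noteq> w" "a \<noteq> w \<or> b \<notin> {b0, c}" for a b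
  proof -
    have "h a b = h1 a b" by (rule out[OF bt(2)]) (use that in auto)
    also have "\<dots> = g a b" by (rule out1[OF bt(2)]) (use that in auto)
    finally show ?thesis .
  qed
  have hwc: "0 < h w c" using force_in[of w c "{(w, c)}" 1 h1] by (simp add: h_def)
  have hwb: "h w b0 = 0" "h b0 w = 0"
    using out[OF bt(2), of w b0] out[OF bt(2), of b0 w] h1w b0' by auto
  have hcz: "0 < h c z" using hg[of c z] zw cV Qz[OF c(1)] by simp
  \<comment> \<open>The unchosen \<open>c\<close> loses \<open>h c z\<close> uniformly against
    \<open>V - {c}\<close>, exactly its lead over \<open>z\<close>.\<close>
  define h2 where "h2 = (\<lambda>a b. h a b + (if b = c \<and> a \<in> V - {c} then h c z else 0)
      - (if a = c \<and> b \<in> V - {c} then h c z else 0))"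
  have sk2: "skew h2" using skewD[OF sk] unfolding skew_def h2_def by (auto simp: algebra_simps)
  have h2h: "h2 a b = h a b" if "a \<noteq> c" "b \<noteq> c" for a b using that by (simp add: h2_def)
  have G2: "G h2 = V - {c}"
  proof (rule weaken_outside[OF sk sk2 Gh])
    fix u assume u: "u \<notin> V - {c}"
    have "\<forall>a\<in>V - {c}. h2 a u = h a u + int (if u = c then nat (h c z) else 0)"
      using hcz by (auto simp: h2_def)
    then show "\<exists>n. \<forall>a\<in>V - {c}. h2 a u = h a u + int n" ..
  qed (use h2h in auto)
  show False
  proof (rule pendant_contradiction[OF sk2 _ cV(1) zw(1) cV(2) _ refl, of w c])
    show "dominates h2 V (- V)"
      unfolding dominates_def
    proof (intro ballI)
      fix a b assume ab: "a \<in> V" "b \<in> - V"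
      then have "h2 a b = h a b" using cV by (auto simp: h2_def)
      also have "\<dots> = g a b" by (rule hg) (use ab b0' cV zw in auto)
      finally show "0 < h2 a b" using dominatesD[OF dom ab] by simp
    qed
    show "h2 c z = 0" using zw cV by (simp add: h2_def)
    have Q': "V - {c, z} = insert w (Q - {c})" using Q zw cV by blast
    have zero': "h2 x y = 0" if "x \<in> Q - {c}" "y \<in> Q - {c}" for x y
      using h2h[of x y] hg[of x y] zero[OF that] that Q by auto
    show "0 < h2 q c" if "q \<in> V - {c, z}" for q
    proof (cases "q = w")
      case True
      then show ?thesis using hwc hcz zw cV by (simp add: h2_def)
    next
      case False
      then have "q \<in> Q - {c}" using that Q' by blast
      then show ?thesis using Qc[of q] hg[of q c] hcz Q cV by (auto simp: h2_def)
    qed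
    have "strong h2 (Q - {c})"
    proof (rule strongI[OF sk2])
      fix S assume "S \<noteq> {}" "S \<subset> Q - {c}"
      then obtain a b where "a \<in> Q - {c} - S" "b \<in> S" "b \<in> Q - {c}" by blast
      then show "\<exists>a\<in>Q - {c} - S. \<exists>b\<in>S. 0 \<le> h2 a b" using zero'[of a b] by (intro bexI[of _ a] bexI[of _ b]) auto
    qed
    then show "strong h2 (V - {c, z})"
      unfolding Q'
      by (rule strong_insert[OF sk2 _ b0(1) _ b0(1)]) (use h2h hwb b0' cV in auto)
    show "w \<in> V - {c, z}" using zw cV by blast
    show "0 \<le> h2 z w" using h2h[of z w] hg[of z w] zw cV b0' by simp
    show "c \<in> V" by (rule cV)
    show "G h2 = V - {c}" by (rule G2)
  qed
qed

text \<open>Every pair inside \<open>Q = V - {z, w}\<close> is moved towards a tie unless this raises the currently excluded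
  alternative. Afterwards \<open>Q\<close> is strong, or the excluded alternative loses to the rest of \<open>Q\<close>.\<close>

lemma tie_contradiction:
  assumes "skew g" "dominates g V (- V)"
    and zw: "z \<in> V" "w \<in> V" "z \<noteq> w" and "g z w = 0"
    and "\<And>q. q \<in> V - {z, w} \<Longrightarrow> 0 < g q z" and "strong g V"
    and "c \<in> V" "G g = V - {c}"
  shows False
proof -
  define Q where "Q = V - {z, w}"
  define d where "d k = (\<Sum>p\<in>Q \<times> Q. nat \<bar>k (fst p) (snd p)\<bar>)" for k :: "'a \<Rightarrow> 'a \<Rightarrow> int"
  have "False"
    if "skew g" "dominates g V (- V)" "g z w = 0" "\<And>q. q \<in> Q \<Longrightarrow> 0 < g q z" "strong g V" "c \<in> V" "G g = V - {c}"
    for g c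
    using that
  proof (induction "d g" arbitrary: g c rule: less_induct)
    case less
    note g = less.prems(1) and dom = less.prems(2) and zw0 = less.prems(3) and Qz = less.prems(4)
      and str = less.prems(5) and c = less.prems(6,7)
    have cw: "c \<noteq> w" using not_excluded_w[OF zw _ g] Qz c unfolding Q_def by blast
    show False
    proof (cases "\<exists>y\<in>Q - {c}. \<exists>x\<in>Q. g y x < 0")
      case True
      then obtain y x where yx: "y \<in> Q" "y \<noteq> c" "x \<in> Q" "g y x < 0" by blast
      have "0 < g x y" using skewD[OF g, of x y] yx by simp
      have ne: "y \<noteq> x" using yx skew_diag[OF g, of x] by auto
      define k where "k = inc y x g"
      have sk: "skew k" using g by (simp add: k_def)
      have out: "k a b = g a b" if "a \<notin> Q \<or> b \<notin> Q" for a b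
        using that yx by (auto simp: k_def inc_apply)
      have le: "nat \<bar>k a b\<bar> \<le> nat \<bar>g a b\<bar>" for a b
        using yx ne \<open>0 < g x y\<close> by (auto simp: k_def inc_apply)
      have lt: "d k < d g" unfolding d_def
      proof (rule sum_strict_mono_ex1)
        have "nat \<bar>k y x\<bar> < nat \<bar>g y x\<bar>" using yx ne by (simp add: k_def inc_apply)
        then show "\<exists>p\<in>Q \<times> Q. nat \<bar>k (fst p) (snd p)\<bar> < nat \<bar>g (fst p) (snd p)\<bar>"
          using yx by (intro bexI[of _ "(y, x)"]) auto
      qed (use le in auto)
      have dom': "dominates k V (- V)"
        using dom out unfolding dominates_def Q_def by auto
      have str': "strong k V"
      proof (rule strong_mono[OF g sk str])
        fix a b assume "0 \<le> g a b"
        then show "0 \<le> k a b" using yx ne \<open>0 < g x y\<close> by (auto simp: k_def inc_apply)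
      qed
      have tc: "is_tc k V" using dom' str' zw by (auto simp: is_tc_def)
      have Qz': "0 < k q z" if "q \<in> Q" for q using out[of q z] Qz[OF that] by (simp add: Q_def)
      have "x \<in> V" "y \<in> V" using yx by (auto simp: Q_def)
      then obtain c' where c': "c' \<in> V" "G k = V - {c'}"
        using exclusion_step[OF g tc[unfolded k_def] _ _ ne c(1) c(2) yx(2)] c(1) unfolding k_def by blast
      then show False
        using less.hyps[OF lt sk dom' _ Qz' str' c'] out[of z w] zw0 by (simp add: Q_def)
    next
      case False
      then have up: "0 \<le> g y x" if "y \<in> Q - {c}" "x \<in> Q" for y x using that by force
      have zero: "g x y = 0" if "x \<in> Q - {c}" "y \<in> Q - {c}" for x y
        using up[of x y] up[of y x] that skewD[OF g, of x y] by simp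
      show False
      proof (cases "strong g Q")
        case True
        have "Q \<noteq> {}" "Q \<subset> V"
        proof -
          have "card {z, w} < card V" using card_V m2 zw by simp
          then have "\<not> V \<subseteq> {z, w}" by (meson card_mono finite not_le)
          then show "Q \<noteq> {}" unfolding Q_def by blast
          show "Q \<subset> V" using zw by (auto simp: Q_def)
        qed
        then obtain a b where ab: "a \<in> V - Q" "b \<in> Q" "0 \<le> g a b"
          by (rule strong_cut[OF g str])
        have "a \<noteq> z" using ab Qz[of b] skewD[OF g, of b z] by auto
        then have "a = w" using ab by (auto simp: Q_def)
        then show False
          using pendant_contradiction[OF g dom zw zw0 Q_def Qz True ab(2) _ c] ab(3) by blast
      next
        case False
        then obtain S where S: "S \<noteq> {}" "S \<subset> Q" "dominates g S (Q - S)"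
          unfolding strong_def by blast
        \<comment> \<open>No member of \<open>Q\<close> other than \<open>c\<close> loses to a
          member of \<open>Q\<close> any more, so \<open>c\<close> is the only one that
          \<open>S\<close> can dominate.\<close>
        have "Q - S = {c}"
        proof -
          have "b = c" if "b \<in> Q - S" for b
          proof (rule ccontr)
            assume "b \<noteq> c"
            obtain a where "a \<in> S" using S by blast
            then have "0 < g a b" "0 \<le> g b a"
              using S that dominatesD[OF S(3)] up[of b a] \<open>b \<noteq> c\<close> by auto
            then show False using skewD[OF g, of a b] by simp
          qed
          then show ?thesis using S by blast
        qed
        then have SQ: "S = Q - {c}" "c \<in> Q" using S by blast+
        show False
        proof (rule tie_contradiction_zeroed[OF g dom zw zw0 Q_def Qz str SQ(2) c(2) _ zero])
          show "Q \<noteq> {c}" using SQ S by blast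
          show "0 < g q c" if "q \<in> Q - {c}" for q
            using dominatesD[OF S(3), of q c] that SQ by blast
        qed
      qed
    qed
  qed
  then show False using assms unfolding Q_def by blast
qed

end

section \<open>Dominance of choice sets and the end of the induction\<close>

context margin_rule
begin

lemma choice_below_Suc:
  assumes tcb: "tc_below (Suc m)" and chb: "choice_below m"
  shows "choice_below (Suc m)"
  unfolding choice_below_def
proof (intro allI impI)
  fix g :: "'a \<Rightarrow> 'a \<Rightarrow> int" assume g: "skew g" and lt: "card (G g) < Suc m"
  define X where "X = G g"
  have X0: "X \<noteq> {}" using ne[OF g] by (simp add: X_def)
  show "is_tc g (G g)"
  proof (cases "card X < m")
    case True
    then show ?thesis using chb g unfolding choice_below_def X_def by blast
  next
    case False
    with lt have card: "card X = m" by (simp add: X_def)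
    have str: "strong g X" using choice_strong[OF tcb g] lt by (simp add: X_def)
    have "dominates g X (- X)"
    proof (cases "m \<le> 1")
      case True
      have "card X \<noteq> 0" using X0 by simp
      then have "card X = 1" using True card by simp
      then obtain w where w: "X = {w}" by (meson card_1_singletonE)
      then have "m = 1" using card by simp
      then show ?thesis using singleton_choice_dominates[OF _ g, of w] tcb w by (simp add: X_def numeral_2_eq_2)
    next
      case False
      then have m2: "2 \<le> m" by simp
      show ?thesis
      proof (rule ccontr)
        assume "\<not> ?thesis"
        then obtain x0 z where z: "x0 \<in> X" "z \<notin> X" "g x0 z \<le> 0" by (force simp: dominates_def)
        define V where "V = insert z X"
        interpret critical G m V
          by unfold_locales (use tcb chb m2 card z in \<open>auto simp: V_def\<close>)
        \<comment> \<open>The least margin of \<open>X\<close> over \<open>z\<close>. Weakening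
          \<open>z\<close> by \<open>- \<mu>\<close> makes all of \<open>X\<close> at least tie with
          \<open>z\<close>, with equality at \<open>w\<close>.\<close>
        define \<mu> where "\<mu> = Min ((\<lambda>x. g x z) ` X)"
        have \<mu>_le: "\<mu> \<le> g x z" if "x \<in> X" for x
          unfolding \<mu>_def by (rule Min_le) (use that in auto)
        have "\<mu> \<in> (\<lambda>x. g x z) ` X" unfolding \<mu>_def by (rule Min_in) (use X0 in auto)
        then obtain w where w: "w \<in> X" "g w z = \<mu>" by blast
        have \<mu>0: "\<mu> \<le> 0" using \<mu>_le[OF z(1)] z(3) by simp
        obtain N :: nat where N: "\<And>a b. \<bar>g a b\<bar> < int N" using ex_bound by blast
        \<comment> \<open>\<open>X\<close> gains \<open>- \<mu>\<close> over \<open>z\<close> and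
          the large \<open>N\<close> over the other outsiders. In \<open>h\<close>, \<open>z\<close>
          is also put above those, which makes \<open>V\<close> dominant.\<close>
        define f where "f a b = (if b = z then g a b - \<mu> else g a b + int N)" for a b
        define h where "h = (\<lambda>a b. if a \<in> X \<and> b \<in> X then g a b
            else if a \<in> X then f a b else if b \<in> X then - f b a
            else if a = z \<and> b \<noteq> z then 1 else if b = z \<and> a \<noteq> z then - 1 else 0)"
        have skh: "skew h" using skewD[OF g] by (auto simp: skew_def h_def)
        have hX: "h a b = g a b" if "a \<in> X" "b \<in> X" for a b using that by (simp add: h_def)
        have Gh: "G h = X"
        proof (rule weaken_outside[OF g skh X_def[symmetric] hX])
          fix u assume u: "u \<notin> X"
          have "\<forall>a\<in>X. h a u = g a u + int (if u = z then nat (- \<mu>) else N)"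
            using u \<mu>0 by (auto simp: h_def f_def)
          then show "\<exists>n. \<forall>a\<in>X. h a u = g a u + int n" ..
        qed
        have dom: "dominates h V (- V)"
          unfolding dominates_def
        proof (intro ballI)
          fix a b assume "a \<in> V" "b \<in> - V"
          then show "0 < h a b" using N[of a b] z by (auto simp: h_def f_def V_def)
        qed
        have hz: "0 \<le> h x z" if "x \<in> X" for x using \<mu>_le[OF that] that z by (simp add: h_def f_def)
        have hw: "h w z = 0" using w z by (simp add: h_def f_def)
        have wz: "w \<noteq> z" using w z by blast
        \<comment> \<open>All of \<open>X\<close> except \<open>w\<close> is made to beat
          \<open>z\<close>, while \<open>w\<close> keeps its tie, as
          \<open>tie_contradiction\<close> requires.\<close>
        define A where "A = (X - {w}) \<times> {z}"
        define k0 where "k0 = force A 1 h"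
        have sk0: "skew k0" unfolding k0_def by (rule skew_force[OF skh]) (use z in \<open>auto simp: A_def\<close>)
        have out: "k a b = h a b" if "between h k0 k" "(a, b) \<notin> A" "(b, a) \<notin> A" for k a b
          using between_force_out[OF that(1)[unfolded k0_def]] that(2,3) by blast
        have ktie: "k w z = 0" "k z w = 0" if "skew k" "between h k0 k" for k
          using out[OF that(2), of w z] hw skewD[OF that(1), of w z] wz by (auto simp: A_def)
        have ktc: "is_tc k V" if k: "skew k" "between h k0 k" for k
        proof -
          have "k a b = g a b" if "a \<in> X" "b \<in> X" for a b
            using out[OF k(2), of a b] hX[OF that] that z by (auto simp: A_def)
          then have "strong k X" using strong_mono[OF g k(1) str] by simp
          then have "strong k V"
            unfolding V_def by (rule strong_insert[OF k(1) _ w(1) _ w(1)]) (use ktie[OF k] in auto)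
          moreover have "k a b = h a b" if "a \<in> V" "b \<in> - V" for a b
            by (rule out[OF k(2)]) (use that in \<open>auto simp: A_def V_def\<close>)
          then have "dominates k V (- V)" using dom unfolding dominates_def by simp
          ultimately show ?thesis by (auto simp: is_tc_def V_def)
        qed
        have "X = V - {z}" using z by (auto simp: V_def)
        \<comment> \<open>The condition on \<open>c\<close> guarantees that a raised
          \<open>y\<close>, whose margin over \<open>z\<close> is still below 1, is never the
          excluded alternative.\<close>
        then have "\<exists>c\<in>V. G h = V - {c} \<and> (c = z \<or> 1 \<le> h c z)" using Gh by (auto simp: V_def)
        with skh sk0 have "\<exists>c\<in>V. G k0 = V - {c} \<and> (c = z \<or> 1 \<le> k0 c z)"
        proof (induction rule: path_induct)
          case (step k y x)
          then obtain c where c: "c \<in> V" "G k = V - {c}" "c = z \<or> 1 \<le> k c z" by blast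
          have "(y, x) \<in> A" "k y x < 1"
            using force_step[OF skh step(4)] step(5) unfolding k0_def by auto
          then have yx: "y \<in> X" "x = z" "k y z < 1" by (auto simp: A_def)
          have sk: "skew (inc y x k)" using step(1) by simp
          have "0 \<le> k y z"
            using hz[OF yx(1)] step(4) yx(2) by simp
          then have "1 \<le> inc y x k y z" using yx \<open>y \<noteq> x\<close> by (simp add: inc_apply)
          moreover have "y \<noteq> c" using c(3) yx z by auto
          moreover have "y \<in> V" "x \<in> V" using yx by (auto simp: V_def)
          moreover have "inc y x k c z = k c z" using \<open>y \<noteq> c\<close> yx c \<open>y \<noteq> x\<close>
            by (auto simp: inc_apply)
          ultimately show ?case
            using exclusion_step[OF step(1) ktc[OF sk step(3)] _ _ step(6) c(1,2)] c yx(2) by fastforce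
        qed
        then obtain c where c: "c \<in> V" "G k0 = V - {c}" by blast
        have bt: "between h k0 k0" by (auto simp: between_def)
        show False
        proof (rule tie_contradiction[OF sk0 _ _ _ wz[symmetric] _ _ _ c])
          show "dominates k0 V (- V)" "strong k0 V"
            using ktc[OF sk0 bt] by (auto simp: is_tc_def)
          show "z \<in> V" "w \<in> V" using w by (auto simp: V_def)
          show "k0 z w = 0" using ktie[OF sk0 bt] by simp
          show "0 < k0 q z" if "q \<in> V - {z, w}" for q
            using force_in[of q z A 1 h] that by (auto simp: A_def V_def k0_def)
        qed
      qed
    qed
    then show ?thesis using str X0 by (simp add: is_tc_def X_def)
  qed
qed

theorem choice_is_tc:
  assumes "skew g" "is_tc g V"
  shows "G g = V"
proof -
  have "tc_below n \<and> choice_below n" for n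
    by (induction n) (auto simp: tc_below_def[of 0] choice_below_def[of 0] tc_below_Suc choice_below_Suc)
  then show ?thesis using assms unfolding tc_below_def by (meson lessI)
qed

end

section \<open>Profiles and margins\<close>

definition vote :: "('a \<times> 'a) set \<Rightarrow> 'a \<Rightarrow> 'a \<Rightarrow> int" where
  "vote r a b = of_bool ((a, b) \<in> r) - of_bool ((b, a) \<in> r)"

lemma vote_le_1: "vote r a b \<le> 1"
  by (simp add: vote_def)

lemma vote_linear:
  assumes "strict_linear_order_on UNIV r"
  shows "vote r a b = (if a = b then 0 else 2 * of_bool ((a, b) \<in> r) - 1)"
proof -
  have "(a, b) \<in> r \<Longrightarrow> (b, a) \<notin> r" "a \<noteq> b \<Longrightarrow> (a, b) \<in> r \<or> (b, a) \<in> r"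
    using assms unfolding strict_linear_order_on_def trans_def irrefl_def total_on_def by blast+
  then show ?thesis by (auto simp: vote_def)
qed

lemma vote_converse: "vote (r\<inverse>) a b = - vote r a b"
  by (simp add: vote_def)

lemma strict_linear_order_converse:
  "strict_linear_order_on UNIV r \<Longrightarrow> strict_linear_order_on UNIV (r\<inverse>)"
  unfolding strict_linear_order_on_def by (auto simp: irrefl_def total_on_def)

lemma margin_sum:
  assumes "finite (fst R)"
  shows "margin R a b = (\<Sum>i\<in>fst R. vote (snd R i) a b)"
proof -
  have "int (card {i \<in> fst R. Q i}) = (\<Sum>i\<in>fst R. of_bool (Q i))" for Q
    using assms by (simp add: sum_of_bool_eq Int_def)
  then show ?thesis unfolding margin_def vote_def by (simp add: sum_subtractf)
qed

lemma skew_margin: "skew (margin R)"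
  by (simp add: skew_def margin_def)

lemma margin_copies:
  assumes R: "finite (fst R)" and R': "finite (fst R')" and copies: "copies_of k R' R"
  shows "margin R' a b = int k * margin R a b"
proof -
  obtain h where h: "h ` fst R' \<subseteq> fst R" "\<And>i. i \<in> fst R \<Longrightarrow> card {j \<in> fst R'. h j = i} = k"
    "\<And>j. j \<in> fst R' \<Longrightarrow> snd R' j = snd R (h j)"
    using copies unfolding copies_of_def by blast
  have "margin R' a b = (\<Sum>j\<in>fst R'. vote (snd R (h j)) a b)"
    using h(3) by (simp add: margin_sum[OF R'])
  also have "\<dots> = (\<Sum>i\<in>fst R. \<Sum>j\<in>{j \<in> fst R'. h j = i}. vote (snd R (h j)) a b)"
    by (rule sum.group[symmetric]) (use R R' h in auto)
  also have "\<dots> = (\<Sum>i\<in>fst R. int k * vote (snd R i) a b)"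
  proof (rule sum.cong[OF refl])
    fix i assume "i \<in> fst R"
    have "(\<Sum>j\<in>{j \<in> fst R'. h j = i}. vote (snd R (h j)) a b) = (\<Sum>j\<in>{j \<in> fst R'. h j = i}. vote (snd R i) a b)"
      by (rule sum.cong) auto
    then show "(\<Sum>j\<in>{j \<in> fst R'. h j = i}. vote (snd R (h j)) a b) = int k * vote (snd R i) a b"
      using h(2)[OF \<open>i \<in> fst R\<close>] by simp
  qed
  finally show ?thesis by (simp add: margin_sum[OF R] sum_distrib_left)
qed

text \<open>Voter \<open>i\<close> becomes the block of the \<open>k\<close> numbers
  \<open>j\<close> with \<open>j div k = i\<close>. The number 0 stays outside the electorate
  because \<open>0 div k = 0\<close> is not a voter.\<close>

definition replicate_profile :: "nat \<Rightarrow> 'a profile \<Rightarrow> 'a profile" where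
  "replicate_profile k R = ({j. j div k \<in> fst R}, \<lambda>j. snd R (j div k))"

lemma replicate_profile:
  assumes R: "valid_profile R" and k: "1 \<le> k"
  shows "valid_profile (replicate_profile k R)" "copies_of k (replicate_profile k R) R"
proof -
  have block: "{j. j div k = i} = {k * i..<k * i + k}" for i
    using k dividend_less_times_div[of k]
    by (auto simp: add.commute intro!: div_nat_eqI)
  have "{j. j div k \<in> fst R} = (\<Union>i\<in>fst R. {j. j div k = i})" by auto
  then have fin: "finite {j. j div k \<in> fst R}" using R by (simp add: valid_profile_def block)
  obtain i where i: "i \<in> fst R" using R by (auto simp: valid_profile_def)
  then have "k * i div k \<in> fst R" using k by simp
  then have "{j. j div k \<in> fst R} \<noteq> {}" by blast
  then show "valid_profile (replicate_profile k R)"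
    using R fin unfolding valid_profile_def replicate_profile_def by auto
  have "card {j \<in> {j. j div k \<in> fst R}. j div k = i} = k" if "i \<in> fst R" for i
  proof -
    have "{j \<in> {j. j div k \<in> fst R}. j div k = i} = {j. j div k = i}" using that by auto
    then show ?thesis by (simp add: block)
  qed
  then show "copies_of k (replicate_profile k R) R"
    unfolding copies_of_def replicate_profile_def by (intro exI[of _ "\<lambda>j. j div k"]) auto
qed

section \<open>Realizing doubled skew-symmetric matrices by lists of votes\<close>

definition list_profile :: "('a \<times> 'a) set list \<Rightarrow> 'a profile" where
  "list_profile L = ({1..length L}, \<lambda>i. if i \<in> {1..length L} then L ! (i - 1) else {})"

definition linear_votes :: "('a \<times> 'a) set list \<Rightarrow> bool" where
  "linear_votes L \<longleftrightarrow> L \<noteq> [] \<and> (\<forall>r\<in>set L. strict_linear_order_on UNIV r)"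

lemma valid_list_profile: "linear_votes L \<Longrightarrow> valid_profile (list_profile L)"
  by (auto simp: valid_profile_def list_profile_def linear_votes_def Suc_le_eq)

lemma margin_list_profile: "margin (list_profile L) a b = (\<Sum>r\<leftarrow>L. vote r a b)"
proof -
  have "margin (list_profile L) a b = (\<Sum>i\<in>{Suc 0..length L}. vote (L ! (i - 1)) a b)"
    by (simp add: margin_sum list_profile_def)
  also have "\<dots> = (\<Sum>i<length L. vote (L ! i) a b)"
    by (simp add: sum.atLeast1_atMost_eq)
  also have "\<dots> = (\<Sum>r\<leftarrow>L. vote r a b)"
    by (simp add: sum_list_sum_nth atLeast0LessThan)
  finally show ?thesis .
qed

text \<open>McGarvey's construction: one unit for \<open>y\<close> over \<open>x\<close> costs two
  votes that both rank \<open>y\<close> directly above \<open>x\<close> and are opposite on all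
  other pairs, whence the factor 2.\<close>

lemma ex_votes_with_margin:
  fixes h :: "'a::finite \<Rightarrow> 'a \<Rightarrow> int"
  assumes h: "skew h"
  shows "\<exists>L. linear_votes L \<and> margin (list_profile L) = (\<lambda>a b. 2 * h a b)"
proof -
  obtain e :: "'a \<Rightarrow> int" where e: "inj e" using ex_injection by blast
  then have e': "inj (\<lambda>a. - e a)" by (auto simp: inj_def)
  note lin = strict_linear_order_lex_order[OF e] strict_linear_order_lex_order[OF e']
  let ?P = "\<lambda>k :: 'a \<Rightarrow> 'a \<Rightarrow> int. \<exists>L. linear_votes L \<and> margin (list_profile L) = (\<lambda>a b. 2 * k a b)"
  have "skew (\<lambda>a b :: 'a. 0)" by (simp add: skew_def)
  moreover note h
  moreover have "?P (\<lambda>a b. 0)"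
  proof (intro exI conjI)
    \<comment> \<open>Two opposite votes, since the zero matrix too needs a non-empty
      electorate.\<close>
    let ?L = "[lex_order (\<lambda>_. 0) e, lex_order (\<lambda>_. 0) (\<lambda>a. - e a)]"
    show "linear_votes ?L" by (simp add: linear_votes_def lin)
    show "margin (list_profile ?L) = (\<lambda>a b. 2 * 0)"
      by (auto simp: margin_list_profile fun_eq_iff vote_def lex_order_def)
  qed
  ultimately show ?thesis
  proof (induction rule: path_induct)
    case (step k y x)
    then obtain L where L: "linear_votes L" "margin (list_profile L) = (\<lambda>a b. 2 * k a b)" by blast
    define r1 where "r1 = lex_order (\<lambda>a. if a = y then 0 else if a = x then 1 else 2) e"
    define r2 where "r2 = lex_order (\<lambda>a. if a = y then 1 else if a = x then 2 else 0) (\<lambda>a. - e a)"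
    have v: "vote r1 a b + vote r2 a b = 2 * (inc y x k a b - k a b)" for a b
      using \<open>y \<noteq> x\<close> by (auto simp: vote_def r1_def r2_def lex_order_def inc_def)
    have "margin (list_profile (r1 # r2 # L)) a b = 2 * inc y x k a b" for a b
      using v[of a b] fun_cong[OF fun_cong[OF L(2)], of a b] by (simp add: margin_list_profile)
    moreover have "linear_votes (r1 # r2 # L)"
      using L(1) lin by (auto simp: linear_votes_def r1_def r2_def)
    ultimately show ?case by blast
  qed
qed

lemma dominant_iff: "dominant R X \<longleftrightarrow> X \<noteq> {} \<and> dominates (margin R) X (- X)"
  by (simp add: dominant_def dominates_def maj_strict_def Compl_eq_Diff_UNIV)

lemma top_cycle_eqI:
  assumes "is_tc (margin R) V"
  shows "top_cycle R = V"
  unfolding top_cycle_def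
proof (rule the_equality)
  have "V \<subseteq> Y" if "dominant R Y" for Y
    using tc_subset_dominant[OF skew_margin assms] that by (auto simp: dominant_iff)
  moreover have "dominant R V" using assms by (auto simp: is_tc_def dominant_iff)
  ultimately show "dominant R V \<and> (\<forall>Y. dominant R Y \<longrightarrow> V \<subseteq> Y)"
    and "\<And>X. dominant R X \<and> (\<forall>Y. dominant R Y \<longrightarrow> X \<subseteq> Y) \<Longrightarrow> X = V" by blast+
qed

lemma is_tc_top_cycle: "is_tc (margin R) (top_cycle (R :: ('a::finite) profile))"
proof -
  have "dominates (margin R) UNIV (- UNIV)" by (simp add: dominates_def)
  from tc_exists_subset[OF this] obtain V where "is_tc (margin R) V" by blast
  then show ?thesis using top_cycle_eqI by metis
qed

section \<open>The top cycle satisfies the axioms\<close>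

lemma top_cycle_copies:
  fixes R :: "('a::finite) profile"
  assumes "valid_profile R" "valid_profile R'" "copies_of k R' R" "1 \<le> k"
  shows "top_cycle R' = top_cycle R"
proof (rule top_cycle_eqI)
  have "margin R' a b = int k * margin R a b" for a b
    using assms(1,2) margin_copies[OF _ _ assms(3)] by (simp add: valid_profile_def)
  then have "dominates (margin R') S T = dominates (margin R) S T" for S T
    using assms(4) by (simp add: dominates_def zero_less_mult_iff)
  then have "is_tc (margin R') V = is_tc (margin R) V" for V
    by (simp add: is_tc_def strong_def)
  then show "is_tc (margin R') (top_cycle R)" using is_tc_top_cycle by blast
qed

text \<open>Two votes that place \<open>X\<close> on top and are opposite inside \<open>X\<close>
  and inside its complement leave only ties in \<open>X\<close>.\<close>

lemma ex_profile_top_cycle: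
  fixes X :: "('a::finite) set"
  assumes "X \<noteq> {}"
  shows "\<exists>R. valid_profile R \<and> top_cycle R = X"
proof -
  obtain e :: "'a \<Rightarrow> int" where e: "inj e" using ex_injection by blast
  then have e': "inj (\<lambda>a. - e a)" by (auto simp: inj_def)
  let ?k = "\<lambda>a. if a \<in> X then 0 else 1 :: int"
  let ?L = "[lex_order ?k e, lex_order ?k (\<lambda>a. - e a)]"
  have "linear_votes ?L"
    by (simp add: linear_votes_def strict_linear_order_lex_order e e')
  moreover have mg: "margin (list_profile ?L) a b =
      (if a \<in> X \<and> b \<notin> X then 2 else if a \<notin> X \<and> b \<in> X then - 2 else 0)" for a b
    by (auto simp: margin_list_profile vote_def lex_order_def)
  have "strong (margin (list_profile ?L)) X"
  proof (rule strongI[OF skew_margin])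
    fix S assume "S \<noteq> {}" "S \<subset> X"
    then obtain a b where "a \<in> X - S" "b \<in> S" by blast
    then show "\<exists>a\<in>X - S. \<exists>b\<in>S. 0 \<le> margin (list_profile ?L) a b"
      using \<open>S \<subset> X\<close> by (intro bexI[of _ a] bexI[of _ b]) (auto simp: mg)
  qed
  then have "top_cycle (list_profile ?L) = X"
    by (intro top_cycle_eqI) (use assms in \<open>simp add: is_tc_def dominates_def mg\<close>)
  ultimately show ?thesis using valid_list_profile by blast
qed

text \<open>A misreport can only lower the margins of pairs in the true preference. With
  \<open>X\<close> and \<open>Y\<close> the top cycles under \<open>P\<close> and \<open>P'\<close>,
  a preferred \<open>Y\<close> makes \<open>X \<inter> Y\<close> dominant under \<open>P\<close>, so
  \<open>X \<subseteq> Y\<close>; then \<open>X\<close> is dominant under \<open>P'\<close>, so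
  \<open>Y \<subseteq> X\<close>.\<close>

lemma top_cycle_strategyproof:
  fixes P P' :: "nat \<Rightarrow> ('a::finite \<times> 'a) set"
  assumes N: "finite N" "i \<in> N" and eq: "\<And>j. j \<in> N - {i} \<Longrightarrow> P j = P' j"
    and irr: "\<And>a b. (a, b) \<in> P i \<Longrightarrow> (b, a) \<notin> P i"
  shows "\<not> fishburn_pref (P i) (top_cycle (N, P')) (top_cycle (N, P))"
proof
  define X where "X = top_cycle (N, P)"
  define Y where "Y = top_cycle (N, P')"
  let ?g = "margin (N, P)" and ?g' = "margin (N, P')"
  assume "fishburn_pref (P i) (top_cycle (N, P')) (top_cycle (N, P))"
  then have YX: "Y \<noteq> X" "\<And>y x. y \<in> Y - X \<Longrightarrow> x \<in> X \<Longrightarrow> (y, x) \<in> P i"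
    "\<And>y x. y \<in> Y \<Longrightarrow> x \<in> X - Y \<Longrightarrow> (y, x) \<in> P i"
    unfolding fishburn_pref_def X_def Y_def by blast+
  have X: "is_tc ?g X" and Y: "is_tc ?g' Y"
    by (simp_all add: X_def Y_def is_tc_top_cycle)
  have domX: "\<And>a b. a \<in> X \<Longrightarrow> b \<notin> X \<Longrightarrow> 0 < ?g a b" and domY: "\<And>a b. a \<in> Y \<Longrightarrow> b \<notin> Y \<Longrightarrow> 0 < ?g' a b"
    using X Y by (auto simp: is_tc_def dominates_def)
  have le: "?g' a b \<le> ?g a b" if ab: "(a, b) \<in> P i" for a b
  proof -
    have "vote (P' j) a b \<le> vote (P j) a b" if "j \<in> N" for j
    proof (cases "j = i")
      case True
      then show ?thesis using ab irr[OF ab] vote_le_1[of "P' i" a b] by (simp add: vote_def[of "P i"])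
    qed (use eq[of j] that in simp)
    then show ?thesis using N by (simp add: margin_sum sum_mono)
  qed
  have le': "?g b a \<le> ?g' b a" if ab: "(a, b) \<in> P i" for a b
    using le[OF ab] skewD[OF skew_margin, of "(N, P)" a b] skewD[OF skew_margin, of "(N, P')" a b] by simp
  have "X \<inter> Y \<noteq> {}"
  proof
    assume dis: "X \<inter> Y = {}"
    obtain x y where "x \<in> X" "y \<in> Y" using X Y by (auto simp: is_tc_def)
    then have "0 < ?g x y" "0 < ?g' y x" "(y, x) \<in> P i" using dis domX[of x y] domY[of y x] YX(2)[of y x] by blast+
    then show False using le'[of y x] skewD[OF skew_margin, of "(N, P')" x y] by simp
  qed
  moreover have "dominates ?g (X \<inter> Y) (- (X \<inter> Y))"
    unfolding dominates_def
  proof (intro ballI)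
    fix a b assume ab: "a \<in> X \<inter> Y" "b \<in> - (X \<inter> Y)"
    show "0 < ?g a b"
    proof (cases "b \<in> X")
      case True
      then have "0 < ?g' a b" "(a, b) \<in> P i" using ab domY[of a b] YX(3)[of a b] by blast+
      then show ?thesis using le[of a b] by simp
    qed (use ab domX in blast)
  qed
  ultimately have sub: "X \<subseteq> Y" using tc_subset_dominant[OF skew_margin X] by blast
  have "dominates ?g' X (- X)"
    unfolding dominates_def
  proof (intro ballI)
    fix a b assume ab: "a \<in> X" "b \<in> - X"
    show "0 < ?g' a b"
    proof (cases "b \<in> Y")
      case True
      then have "0 < ?g a b" "(b, a) \<in> P i" using ab domX[of a b] YX(2)[of b a] by blast+
      then show ?thesis using le'[of b a] by simp
    qed (use ab domY sub in blast)
  qed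
  then have "Y \<subseteq> X" using tc_subset_dominant[OF skew_margin Y] X by (auto simp: is_tc_def)
  then show False using sub YX(1) by blast
qed

section \<open>The characterization\<close>

lemma axioms_imp_top_cycle:
  fixes f :: "('a::finite) profile \<Rightarrow> 'a set"
  assumes scc: "is_SCC f" and pw: "pairwise_SCC f" and sp: "strategyproof f"
    and sni: "set_non_imposition f" and hom: "homogeneous f" and R: "valid_profile R"
  shows "f R = top_cycle R"
proof -
  \<comment> \<open>Any votes with margins \<open>2 * h\<close> will do, as pairwiseness makes the
    value of \<open>f\<close> independent of the choice.\<close>
  define votes where "votes h = (SOME L. linear_votes L \<and> margin (list_profile L) = (\<lambda>a b. 2 * h a b))"
    for h :: "'a \<Rightarrow> 'a \<Rightarrow> int"
  define G where "G h = f (list_profile (votes h))" for h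
  have votes: "linear_votes (votes h)" "margin (list_profile (votes h)) = (\<lambda>a b. 2 * h a b)" if "skew h" for h
    using someI_ex[OF ex_votes_with_margin[OF that]] unfolding votes_def by blast+
  have same: "f R1 = f R2" if "valid_profile R1" "valid_profile R2" "margin R1 = margin R2" for R1 R2
    using pw that unfolding pairwise_SCC_def by blast
  have G: "G h = f R1" if "skew h" "valid_profile R1" "margin R1 = (\<lambda>a b. 2 * h a b)" for h R1
    unfolding G_def
    by (rule same[OF valid_list_profile[OF votes(1)[OF that(1)]] that(2)]) (simp add: votes(2)[OF that(1)] that(3))
  have rep: "f (replicate_profile k R1) = f R1" "margin (replicate_profile k R1) = (\<lambda>a b. int k * margin R1 a b)"
    if "valid_profile R1" "1 \<le> k" for k R1
  proof -
    note v = replicate_profile[OF that]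
    show "f (replicate_profile k R1) = f R1" using hom v that unfolding homogeneous_def by blast
    show "margin (replicate_profile k R1) = (\<lambda>a b. int k * margin R1 a b)"
      using margin_copies[OF _ _ v(2)] v(1) that(1) unfolding valid_profile_def by blast
  qed
  \<comment> \<open>Two copies of \<open>R1\<close> have the doubled margins through which
    \<open>G\<close> is defined.\<close>
  have f_G: "f R1 = G (margin R1)" if "valid_profile R1" for R1
    using G[OF skew_margin replicate_profile(1)[OF that, of 2], of R1] rep[OF that, of 2] by simp
  interpret margin_rule G
  proof
    fix g :: "'a \<Rightarrow> 'a \<Rightarrow> int" and r r' :: "('a \<times> 'a) set"
    assume g: "skew g" and r: "strict_linear_order_on UNIV r" "strict_linear_order_on UNIV r'"
      and g': "skew (shift r r' g)"
    \<comment> \<open>The vote \<open>r\<close> and its converse cancel in the margins and provide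
      voter 1 with true vote \<open>r\<close>; replacing it by \<open>r'\<close> changes the margins
      by twice the shift.\<close>
    let ?L = "r # r\<inverse> # votes g" and ?L' = "r' # r\<inverse> # votes g"
    have lin: "linear_votes ?L" "linear_votes ?L'"
      using votes(1)[OF g] r strict_linear_order_converse[OF r(1)] by (auto simp: linear_votes_def)
    have mv: "(\<Sum>r\<leftarrow>votes g. vote r a b) = 2 * g a b" for a b
      using fun_cong[OF fun_cong[OF votes(2)[OF g]], of a b] by (simp add: margin_list_profile)
    have "margin (list_profile ?L) a b = 2 * g a b" for a b
      by (simp add: margin_list_profile mv vote_converse)
    then have "G g = f (list_profile ?L)" using G[OF g valid_list_profile[OF lin(1)]] by blast
    moreover have "margin (list_profile ?L') a b = 2 * shift r r' g a b" for a b
    proof (cases "a = b")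
      case True
      then show ?thesis using skew_diag[OF g, of b] skew_diag[OF g', of b]
        by (simp add: margin_list_profile mv vote_converse vote_linear r)
    next
      case False
      then show ?thesis
        by (simp add: margin_list_profile mv vote_converse vote_linear r shift_def)
    qed
    then have "G (shift r r' g) = f (list_profile ?L')" using G[OF g' valid_list_profile[OF lin(2)]] by blast
    moreover have "\<not> fishburn_pref (snd (list_profile ?L) 1) (f (list_profile ?L')) (f (list_profile ?L))"
    proof -
      let ?N = "{1..length ?L}"
      have N: "list_profile ?L = (?N, snd (list_profile ?L))" "list_profile ?L' = (?N, snd (list_profile ?L'))"
        by (simp_all add: list_profile_def)
      have "\<forall>j\<in>?N - {1}. snd (list_profile ?L) j = snd (list_profile ?L') j"
        by (auto simp: list_profile_def nth_Cons')
      moreover have "1 \<in> ?N" by simp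
      ultimately show ?thesis
        using sp valid_list_profile[OF lin(1)] valid_list_profile[OF lin(2)] N
        unfolding strategyproof_def by metis
    qed
    ultimately show "\<not> fishburn_pref r (G (shift r r' g)) (G g)"
      by (simp add: list_profile_def)
  next
    fix g :: "'a \<Rightarrow> 'a \<Rightarrow> int" and n :: nat
    assume g: "skew g" and n: "1 \<le> n"
    have "skew (\<lambda>a b. int n * g a b)"
      using skewD[OF g] unfolding skew_def by (metis distrib_left mult_zero_right)
    then have "G (\<lambda>a b. int n * g a b) = f (replicate_profile n (list_profile (votes g)))"
      by (rule G) (use valid_list_profile[OF votes(1)[OF g]] n votes(2)[OF g] in
          \<open>simp_all add: replicate_profile(1) rep(2) fun_eq_iff\<close>)
    then show "G (\<lambda>a b. int n * g a b) = G g"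
      using rep(1)[OF valid_list_profile[OF votes(1)[OF g]] n] by (simp add: G_def)
  next
    fix X :: "'a set" assume "X \<noteq> {}"
    then obtain R1 where "valid_profile R1" "f R1 = X" using sni unfolding set_non_imposition_def by blast
    then show "\<exists>g. skew g \<and> G g = X" using f_G skew_margin by metis
  next
    fix g :: "'a \<Rightarrow> 'a \<Rightarrow> int" assume "skew g"
    then show "G g \<noteq> {}"
      using scc valid_list_profile[OF votes(1)] unfolding G_def is_SCC_def by blast
  qed
  show ?thesis using f_G[OF R] choice_is_tc[OF skew_margin is_tc_top_cycle] by simp
qed

theorem theorem2:
  fixes f :: "('a::finite) profile \<Rightarrow> 'a set"
  assumes "is_SCC f" and "pairwise_SCC f"
  shows "(strategyproof f \<and> set_non_imposition f \<and> homogeneous f) \<longleftrightarrow>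
         (\<forall>R. valid_profile R \<longrightarrow> f R = top_cycle R)"
proof
  assume "strategyproof f \<and> set_non_imposition f \<and> homogeneous f"
  then show "\<forall>R. valid_profile R \<longrightarrow> f R = top_cycle R"
    using axioms_imp_top_cycle[OF assms] by blast
next
  assume tc: "\<forall>R. valid_profile R \<longrightarrow> f R = top_cycle R"
  have "strategyproof f"
    unfolding strategyproof_def
  proof (intro allI impI)
    fix N and P P' :: "nat \<Rightarrow> ('a \<times> 'a) set" and i
    assume v: "valid_profile (N, P)" "valid_profile (N, P')" and i: "i \<in> N" and eq: "\<forall>j\<in>N - {i}. P j = P' j"
    have "strict_linear_order_on UNIV (P i)" using v(1) i by (simp add: valid_profile_def)
    then have "(a, b) \<in> P i \<Longrightarrow> (b, a) \<notin> P i" for a b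
      unfolding strict_linear_order_on_def trans_def irrefl_def by blast
    then have "\<not> fishburn_pref (P i) (top_cycle (N, P')) (top_cycle (N, P))"
      using v i eq by (intro top_cycle_strategyproof) (auto simp: valid_profile_def)
    then show "\<not> fishburn_pref (P i) (f (N, P')) (f (N, P))" using tc v by simp
  qed
  moreover have "set_non_imposition f"
    unfolding set_non_imposition_def using ex_profile_top_cycle tc by metis
  moreover have "homogeneous f"
    unfolding homogeneous_def using top_cycle_copies tc by metis
  ultimately show "strategyproof f \<and> set_non_imposition f \<and> homogeneous f" by blast
qed

end
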